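(* Let $n$ be a positive integer with $n\equiv3,4,5,6,7\pmod 8$. Then for every $c\in\mathbb{Q}_2$ the discriminant $\operatorname{disc}(H_{n;c})$ of the polynomial $H_{n;c}(x)=H_n(x)+c\,H_{n-1}(x)$ is not a square in $\mathbb{Q}_2$.
   Context: $\mathbb{Q}_2$ is the field of $2$-adic numbers. $H_n$ is the $n$-th (physicists') Hermite polynomial, $H_n(x)=(-1)^ne^{x^2}\frac{d^n}{dx^n}e^{-x^2}=\sum_{k=0}^{\lfloor n/2\rfloor}(-1)^k\frac{n!}{k!(n-2k)!}(2x)^{n-2k}\in\mathbb{Z}[x]$. For a polynomial $f=a_0\prod_{i=1}^n(x-\alpha_i)$ of degree $n$ (roots in an algebraic closure), $\operatorname{disc}(f)=a_0^{2n-2}\prod_{1\le i<j\le n}(\alpha_i-\alpha_j)^2$. *)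

theory Defs
  imports
    "HOL-Algebra.Algebraic_Closure_Type"
    "HOL-Computational_Algebra.Computational_Algebra"
    "HOL-Combinatorics.Permutations"
begin

text \<open>
  The ring of 2-adic integers as the inverse limit of the rings of integers modulo
  \<open>2 ^ n\<close>: an element is the sequence of its residues, the \<open>n\<close>-th one being represented in
  \<open>{0..<2 ^ n}\<close>.  The single compatibility equation below also enforces that range.
\<close>

typedef two_adic_int = "{x :: nat \<Rightarrow> int. \<forall>n. x (Suc n) mod 2 ^ n = x n}"
  morphisms residue Abs_two_adic_int
  by (rule exI[of _ "\<lambda>_. 0"]) simp

setup_lifting type_definition_two_adic_int

lemma mod_mod_two_power_Suc: "(a :: int) mod 2 ^ Suc n mod 2 ^ n = a mod 2 ^ n"
  by (rule mod_mod_cancel) simp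

instantiation two_adic_int :: comm_ring_1
begin

lift_definition zero_two_adic_int :: two_adic_int is "\<lambda>_. 0"
  by simp

lift_definition one_two_adic_int :: two_adic_int is "\<lambda>n. 1 mod 2 ^ n"
  by (simp only: mod_mod_two_power_Suc simp_thms)

lift_definition plus_two_adic_int :: "two_adic_int \<Rightarrow> two_adic_int \<Rightarrow> two_adic_int"
  is "\<lambda>x y n. (x n + y n) mod 2 ^ n"
  by (metis (no_types, lifting) mod_add_eq mod_mod_two_power_Suc)

lift_definition times_two_adic_int :: "two_adic_int \<Rightarrow> two_adic_int \<Rightarrow> two_adic_int"
  is "\<lambda>x y n. (x n * y n) mod 2 ^ n"
  by (metis (no_types, lifting) mod_mult_eq mod_mod_two_power_Suc)

lift_definition uminus_two_adic_int :: "two_adic_int \<Rightarrow> two_adic_int"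
  is "\<lambda>x n. (- x n) mod 2 ^ n"
  by (metis (no_types, lifting) mod_minus_eq mod_mod_two_power_Suc)

definition minus_two_adic_int :: "two_adic_int \<Rightarrow> two_adic_int \<Rightarrow> two_adic_int"
  where "minus_two_adic_int x y = x + (- y)"

instance
proof
  fix a b c :: two_adic_int
  show "a * b * c = a * (b * c)"
    by transfer (simp add: mod_simps mult.assoc)
  show "a * b = b * a"
    by transfer (simp add: mult.commute)
  show "1 * a = a"
    by transfer (rule ext, metis mod_mod_trivial mod_mult_left_eq mult_1)
  show "a + b + c = a + (b + c)"
    by transfer (simp add: mod_simps add.assoc)
  show "a + b = b + a"
    by transfer (simp add: add.commute)
  show "0 + a = a"
    by transfer (rule ext, metis mod_mod_trivial add_0)
  show "- a + a = 0"
    by transfer (simp add: mod_simps)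
  show "a - b = a + - b"
    by (rule minus_two_adic_int_def)
  show "(a + b) * c = a * c + b * c"
    by transfer (simp add: mod_simps distrib_right)
  show "(0 :: two_adic_int) \<noteq> 1"
    by transfer (auto simp: fun_eq_iff intro!: exI[of _ 1])
qed

end

lemma residue_mod: "residue x (m + k) mod 2 ^ m = residue x m"
proof (induction k)
  case 0
  have "residue x (Suc m) mod 2 ^ m = residue x m"
    by transfer simp
  then show ?case by (metis add_0_right mod_mod_trivial)
next
  case (Suc k)
  have "residue x (Suc (m + k)) mod 2 ^ (m + k) = residue x (m + k)"
    by transfer simp
  then have "residue x (Suc (m + k)) mod 2 ^ (m + k) mod 2 ^ m = residue x m"
    using Suc by simp
  moreover have "(2 :: int) ^ m dvd 2 ^ (m + k)"
    by (simp add: le_imp_power_dvd)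
  ultimately show ?case by (simp add: mod_mod_cancel)
qed

instance two_adic_int :: idom
proof
  fix a b :: two_adic_int
  assume "a \<noteq> 0" "b \<noteq> 0"
  then obtain i j where i: "residue a i \<noteq> 0" and j: "residue b j \<noteq> 0"
    by (metis ext residue_inject zero_two_adic_int.rep_eq)
  let ?x = "residue a (i + j)" and ?y = "residue b (i + j)"
  have x: "\<not> 2 ^ i dvd ?x"
    using i residue_mod[of a i j] by (simp add: dvd_eq_mod_eq_0)
  have y: "\<not> 2 ^ j dvd ?y"
    using j residue_mod[of b j i] by (simp add: dvd_eq_mod_eq_0 add.commute)
  have p: "prime_elem (2 :: int)" by simp
  have x0: "?x \<noteq> 0" and y0: "?y \<noteq> 0" using x y by auto
  have "multiplicity 2 ?x < i" "multiplicity 2 ?y < j"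
    using x y x0 y0 by (simp_all add: power_dvd_iff_le_multiplicity)
  then have "multiplicity 2 (?x * ?y) < i + j"
    using prime_elem_multiplicity_mult_distrib[OF p x0 y0] by simp
  then have "\<not> 2 ^ (i + j) dvd ?x * ?y"
    using x0 y0 by (simp add: power_dvd_iff_le_multiplicity)
  then have "residue (a * b) (i + j) \<noteq> 0"
    by (simp add: times_two_adic_int.rep_eq dvd_eq_mod_eq_0)
  then show "a * b \<noteq> 0"
    by (auto simp: zero_two_adic_int.rep_eq)
qed

text \<open>The field of 2-adic numbers.\<close>

type_synonym two_adic = "two_adic_int fract"


text \<open>Physicists' Hermite polynomials.\<close>

definition hermite :: "nat \<Rightarrow> int poly" where
  "hermite n = (\<Sum>k\<le>n div 2.
     smult ((-1) ^ k * (fact n div (fact k * fact (n - 2 * k)))) ([:0, 2:] ^ (n - 2 * k)))"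

text \<open>The integer division above is exact.\<close>

lemma hermite_division_exact:
  assumes "k \<le> n div 2"
  shows "(fact k * fact (n - 2 * k) :: int) dvd fact n"
proof -
  have "(fact k * fact (n - 2 * k) :: int) dvd fact (k + (n - 2 * k))"
    by (rule fact_fact_dvd_fact)
  also have "(fact (k + (n - 2 * k)) :: int) dvd fact n"
    by (rule fact_dvd) (use assms in auto)
  finally show ?thesis .
qed


text \<open>
  An enumeration (with multiplicity) of the roots of a polynomial in the algebraic closure
  of its coefficient field.
\<close>

definition is_root_list :: "'a :: field poly \<Rightarrow> 'a alg_closure list \<Rightarrow> bool" where
  "is_root_list p as \<longleftrightarrow>
     map_poly to_ac p = smult (to_ac (lead_coeff p)) (\<Prod>a\<leftarrow>as. [:- a, 1:])"

text \<open>
  The discriminant is formed in the algebraic closure; it is an element of the image of the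
  base field under \<^const>\<open>to_ac\<close>.
  The choice of the enumeration is immaterial, see \<open>discriminant_eq\<close>.
\<close>

definition discriminant :: "'a :: field poly \<Rightarrow> 'a alg_closure" where
  "discriminant p =
     (let as = (SOME as. is_root_list p as)
      in to_ac (lead_coeff p) ^ (2 * degree p - 2) *
         (\<Prod>(i, j) \<in> {(i, j). i < j \<and> j < degree p}. (as ! i - as ! j)\<^sup>2))"

lemma is_root_list_exists:
  assumes "p \<noteq> 0"
  shows "\<exists>as. is_root_list p as"
proof -
  let ?q = "map_poly to_ac p"
  have "?q \<noteq> 0" using assms by (simp add: map_poly_eq_0_iff)
  then obtain A where A: "size A = degree ?q"
    "?q = smult (lead_coeff ?q) (\<Prod>x\<in>#A. [:- x, 1:])"
    using alg_closed_imp_factorization by blast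
  obtain as where as: "mset as = A" using ex_mset by blast
  have "(\<Prod>x\<in>#A. [:- x, 1:]) = (\<Prod>a\<leftarrow>as. [:- a, 1:])"
    by (simp add: prod_mset_prod_list flip: as mset_map)
  moreover have "lead_coeff ?q = to_ac (lead_coeff p)"
    by (simp add: coeff_map_poly degree_map_poly)
  ultimately show ?thesis
    using A unfolding is_root_list_def by auto
qed

lemma order_prod_linear:
  fixes as :: "'a :: field list"
  shows "order x (\<Prod>a\<leftarrow>as. [:- a, 1:]) = count (mset as) x"
proof (induction as)
  case (Cons a as)
  have "(\<Prod>a\<leftarrow>as. [:- a, 1:]) \<noteq> 0" by (auto simp: prod_list_zero_iff)
  then have "[:- a, 1:] * (\<Prod>a\<leftarrow>as. [:- a, 1:]) \<noteq> 0"
    by (simp del: mult_pCons_left)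
  then have "order x ([:- a, 1:] * (\<Prod>a\<leftarrow>as. [:- a, 1:])) =
      order x [:- a, 1:] + order x (\<Prod>a\<leftarrow>as. [:- a, 1:])"
    by (rule order_mult)
  moreover have "order x [:- a, 1:] = (if x = a then 1 else 0)"
    using order_power_n_n[of a 1] by (auto intro: order_0I)
  ultimately show ?case using Cons by auto
qed simp

lemma is_root_list_length:
  assumes "p \<noteq> 0" "is_root_list p as"
  shows "length as = degree p"
proof -
  have "degree (\<Prod>a\<leftarrow>as. [:- a, 1:]) = length as"
  proof (induction as)
    case (Cons a as)
    have "(\<Prod>a\<leftarrow>as. [:- a, 1:]) \<noteq> 0" by (auto simp: prod_list_zero_iff)
    then have "degree ([:- a, 1:] * (\<Prod>a\<leftarrow>as. [:- a, 1:])) = Suc (length as)"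
      using Cons by (subst degree_mult_eq) (simp_all del: mult_pCons_left)
    then show ?case by simp
  qed simp
  moreover have "degree (map_poly to_ac p) = degree p"
    by (simp add: degree_map_poly)
  ultimately show ?thesis
    using assms unfolding is_root_list_def by simp
qed

lemma prod_offdiag_eq:
  fixes f :: "nat \<Rightarrow> 'a :: comm_ring_1"
  shows "(\<Prod>(i, j) \<in> {(i, j). i < n \<and> j < n \<and> i \<noteq> j}. f i - f j) =
         (\<Prod>(i, j) \<in> {(i, j). i < j \<and> j < n}. - 1) *
         (\<Prod>(i, j) \<in> {(i, j). i < j \<and> j < n}. (f i - f j)\<^sup>2)"
proof -
  let ?U = "{(i, j). i < j \<and> j < n}" and ?L = "{(i, j). j < i \<and> i < n}"
  have fin: "finite ?U" by (rule finite_subset[of _ "{..<n} \<times> {..<n}"]) auto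
  have finL: "finite ?L" by (rule finite_subset[of _ "{..<n} \<times> {..<n}"]) auto
  have un: "{(i, j). i < n \<and> j < n \<and> i \<noteq> j} = ?U \<union> ?L" by auto
  have "(\<Prod>(i, j) \<in> ?L. f i - f j) = (\<Prod>(i, j) \<in> ?U. f j - f i)"
    by (rule prod.reindex_bij_witness[of _ prod.swap prod.swap]) auto
  then have "(\<Prod>(i, j) \<in> ?U \<union> ?L. f i - f j) =
      (\<Prod>(i, j) \<in> ?U. f i - f j) * (\<Prod>(i, j) \<in> ?U. f j - f i)"
    using fin finL by (subst prod.union_disjoint) auto
  also have "\<dots> = (\<Prod>(i, j) \<in> ?U. - 1 * (f i - f j)\<^sup>2)"
    unfolding prod.distrib[symmetric]
    by (rule prod.cong) (auto simp: power2_eq_square algebra_simps)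
  also have "\<dots> = (\<Prod>(i, j) \<in> ?U. - 1) * (\<Prod>(i, j) \<in> ?U. (f i - f j)\<^sup>2)"
    unfolding prod.distrib[symmetric] by (rule prod.cong) auto
  finally show ?thesis unfolding un .
qed

lemma prod_sq_diff_permute:
  fixes f :: "nat \<Rightarrow> 'a :: comm_ring_1"
  assumes "\<pi> permutes {..<n}"
  shows "(\<Prod>(i, j) \<in> {(i, j). i < j \<and> j < n}. (f (\<pi> i) - f (\<pi> j))\<^sup>2) =
         (\<Prod>(i, j) \<in> {(i, j). i < j \<and> j < n}. (f i - f j)\<^sup>2)"
proof -
  let ?s = "\<Prod>(i, j) \<in> {(i, j :: nat). i < j \<and> j < n}. (- 1 :: 'a)"
  have s: "?s * ?s = 1" by (simp add: case_prod_unfold flip: prod.distrib)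
  have inv: "inv_into UNIV \<pi> (\<pi> i) = i" "\<pi> (inv_into UNIV \<pi> i) = i" for i
    using permutes_inverses[OF assms] by auto
  have lt: "\<pi> i < n \<longleftrightarrow> i < n" "inv_into UNIV \<pi> i < n \<longleftrightarrow> i < n" for i
    using permutes_in_image[OF assms] permutes_in_image[OF permutes_inv[OF assms]]
    by (auto simp: lessThan_iff)
  have inj: "\<pi> i = \<pi> j \<longleftrightarrow> i = j" "inv_into UNIV \<pi> i = inv_into UNIV \<pi> j \<longleftrightarrow> i = j" for i j
    using inv by metis+
  have "(\<Prod>(i, j) \<in> {(i, j). i < n \<and> j < n \<and> i \<noteq> j}. f (\<pi> i) - f (\<pi> j)) =
        (\<Prod>(i, j) \<in> {(i, j). i < n \<and> j < n \<and> i \<noteq> j}. f i - f j)"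
    by (rule prod.reindex_bij_witness[of _ "map_prod (inv_into UNIV \<pi>) (inv_into UNIV \<pi>)" "map_prod \<pi> \<pi>"])
       (auto simp: inv lt inj)
  then have "?s * (\<Prod>(i, j) \<in> {(i, j). i < j \<and> j < n}. (f (\<pi> i) - f (\<pi> j))\<^sup>2) =
        ?s * (\<Prod>(i, j) \<in> {(i, j). i < j \<and> j < n}. (f i - f j)\<^sup>2)"
    by (simp only: prod_offdiag_eq[of "\<lambda>i. f (\<pi> i)" n] prod_offdiag_eq[of f n])
  then have "?s * ?s * (\<Prod>(i, j) \<in> {(i, j). i < j \<and> j < n}. (f (\<pi> i) - f (\<pi> j))\<^sup>2) =
        ?s * ?s * (\<Prod>(i, j) \<in> {(i, j). i < j \<and> j < n}. (f i - f j)\<^sup>2)"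
    by (simp only: mult.assoc)
  then show ?thesis by (simp only: s mult_1)
qed

lemma discriminant_eq:
  assumes "p \<noteq> 0" "is_root_list p as"
  shows "discriminant p = to_ac (lead_coeff p) ^ (2 * degree p - 2) *
    (\<Prod>(i, j) \<in> {(i, j). i < j \<and> j < degree p}. (as ! i - as ! j)\<^sup>2)"
proof -
  define bs where "bs = (SOME bs. is_root_list p bs)"
  have bs: "is_root_list p bs"
    unfolding bs_def using assms(2) by (rule someI)
  have "(\<Prod>a\<leftarrow>bs. [:- a, 1:]) = (\<Prod>a\<leftarrow>as. [:- a, 1:])"
    using bs assms unfolding is_root_list_def by (metis leading_coeff_0_iff smult_cancel to_ac_eq_0_iff)
  then have "mset bs = mset as"
    by (metis multiset_eqI order_prod_linear)
  then obtain \<pi> where \<pi>: "\<pi> permutes {..<length as}" "permute_list \<pi> as = bs"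
    by (metis mset_eq_permutation)
  have len: "length as = degree p" using assms by (rule is_root_list_length)
  have nth: "bs ! i = as ! \<pi> i" if "i < degree p" for i
    using \<pi> that len by (metis permute_list_nth)
  have "(\<Prod>(i, j) \<in> {(i, j). i < j \<and> j < degree p}. (bs ! i - bs ! j)\<^sup>2) =
        (\<Prod>(i, j) \<in> {(i, j). i < j \<and> j < degree p}. (as ! \<pi> i - as ! \<pi> j)\<^sup>2)"
    by (intro prod.cong) (auto simp: nth)
  also have "\<dots> = (\<Prod>(i, j) \<in> {(i, j). i < j \<and> j < degree p}. (as ! i - as ! j)\<^sup>2)"
    using prod_sq_diff_permute[of \<pi> "degree p" "(!) as"] \<pi> len by simp
  finally show ?thesis
    by (simp add: discriminant_def Let_def bs_def)
qed

end

theory Submission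
  imports Defs
begin

text \<open>
Write \<open>s = c\<^sup>2\<close> and \<open>w = 2 n + s\<close>.  At a root \<open>\<alpha>\<close> of \<open>P = H\<^sub>n + c H\<^sub>n\<^sub>-\<^sub>1\<close> the identities
\<open>H\<^sub>n' = 2 n H\<^sub>n\<^sub>-\<^sub>1\<close> and \<open>H\<^sub>n\<^sub>-\<^sub>1' = 2 x H\<^sub>n\<^sub>-\<^sub>1 - H\<^sub>n\<close> give
\<open>P'(\<alpha>) = (2 c \<alpha> + w) H\<^sub>n\<^sub>-\<^sub>1(\<alpha>)\<close>, so the discriminant splits into two products over the
roots.  As in Schur's computation of the discriminant of \<open>H\<^sub>n\<close>, the product of the
\<open>H\<^sub>n\<^sub>-\<^sub>1(\<alpha>)\<close> is found by descending along the three-term recursion; it does not depend on \<open>c\<close>.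
The product of the linear factors is essentially \<open>P(- w / (2 c))\<close>.  Since the homogenised
Hermite polynomials \<open>F\<^sub>n(w, s)\<close> (\<open>hermite_form\<close>) satisfy the same recursion, it equals
\<open>F\<^sub>n(w, s) - s F\<^sub>n\<^sub>-\<^sub>1(w, s) = 2 G(s)\<close> with
\<open>G(s) = n F\<^sub>n\<^sub>-\<^sub>1(w, s) - (n - 1) s F\<^sub>n\<^sub>-\<^sub>2(w, s)\<close>, called \<open>disc_factor\<close> below.  Thus
(\<open>discriminant_quasi_hermite\<close>)
\<open>disc P = 2\<^bsup>n(n-2)\<^esup> (\<Prod>k<n. (2 k)\<^sup>k) 2 G(c\<^sup>2)\<close>.

A nonzero 2-adic number \<open>2\<^sup>e u\<close> with \<open>u\<close> an odd 2-adic integer can only be a square if \<open>e\<close> is even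
and \<open>u\<close> is congruent to 1 modulo 8.  The square class of the constant in front of \<open>G\<close> depends
only on \<open>n mod 8\<close>: in terms of the parity of \<open>e\<close> and of \<open>u mod 8\<close> it is \<open>(1, 1)\<close>,
\<open>(1, 3)\<close>, \<open>(0, 3)\<close>, \<open>(0, 7)\<close>, \<open>(1, 7)\<close> for \<open>n mod 8 = 3, \<dots>, 7\<close>.  Every class is its own
inverse, so it remains to see that \<open>G(c\<^sup>2)\<close> is never zero and never lies in that class.

This is a computation modulo 8 after removing powers of 2 from \<open>G\<close>.  If \<open>c\<close> is not an integer,
\<open>G(s) / s\<^bsup>n-1\<^esup>\<close> is a polynomial in \<open>1 / s\<close> and is congruent to 1 modulo 4.  If \<open>c\<close> is an odd
integer, \<open>G(s)\<close> itself is odd.  If \<open>c = 2 y\<close>, the homogeneity \<open>F\<^sub>m(2 w, 4 s) = 2\<^sup>m F\<^sub>m(w, s)\<close>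
takes a factor \<open>2\<^bsup>n-1\<^esup>\<close> out of \<open>G\<close> and leaves an expression of the same kind in which \<open>w\<close> is
replaced by \<open>n + 2 y\<^sup>2\<close>.  This is odd for odd \<open>n\<close>.  For even \<open>n\<close> there are two possibilities:
if \<open>y\<close> is even the argument repeats with \<open>n / 2\<close> in the place of \<open>n\<close>; if \<open>y\<close> is odd, then
\<open>F\<^sub>m(2 v, s)\<close> is divisible by a power of 2 which grows like \<open>m / 2\<close>, and
the quotients (\<open>halved_form\<close>) satisfy a recursion of their own.  As \<open>n\<close> is not divisible by 8 the
repetition stops after at most two steps.  Modulo 8 both recursions have period 8 in the index
(\<open>hermite_form_plus_8\<close> for odd \<open>w\<close>, \<open>halved_form_plus_8\<close> for \<open>s\<close> congruent to 1), which leaves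
finitely many values to inspect.
\<close>

section \<open>Homogenised Hermite polynomials\<close>

text \<open>
The weighted homogeneous form of the Hermite polynomials: \<open>w\<close> has weight 1 and \<open>s\<close> has weight 2,
and \<open>H\<^sub>n(x) = hermite_form n (2 x) 1\<close>.  The ring is arbitrary so that the same recursion can be used
for polynomials, in the algebraic closure, for 2-adic integers and for integer residues.
\<close>

fun hermite_form :: "nat \<Rightarrow> 'a \<Rightarrow> 'a \<Rightarrow> 'a :: comm_ring_1" where
  "hermite_form 0 w s = 1"
| "hermite_form (Suc 0) w s = w"
| "hermite_form (Suc (Suc n)) w s =
     w * hermite_form (Suc n) w s - 2 * of_nat (Suc n) * s * hermite_form n w s"

lemma hermite_form_scale:
  "hermite_form n (l * w) (l ^ 2 * s) = l ^ n * hermite_form n w s"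
  by (induction n w s rule: hermite_form.induct) (simp_all add: algebra_simps power2_eq_square)

lemma hermite_form_zero: "hermite_form n w 0 = w ^ n"
  by (induction n w "0::'a" rule: hermite_form.induct) simp_all

text \<open>
This is \<open>n! / (k! (n - 2 k)!)\<close>, written such that it vanishes for \<open>2 k > n\<close>; the three-term
recursion then needs no special treatment of the last summand.
\<close>

definition hermite_coeff :: "nat \<Rightarrow> nat \<Rightarrow> nat" where
  "hermite_coeff n k = (n choose (2 * k)) * (fact (2 * k) div fact k)"

lemma hermite_coeff_mult:
  assumes "2 * k \<le> n"
  shows "hermite_coeff n k * (fact k * fact (n - 2 * k)) = fact n"
proof -
  have "(fact k :: nat) dvd fact (2 * k)" by (simp add: fact_dvd)
  then have "hermite_coeff n k * (fact k * fact (n - 2 * k)) =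
     fact (2 * k) * fact (n - 2 * k) * (n choose (2 * k))"
    by (simp add: hermite_coeff_def algebra_simps)
  then show ?thesis using binomial_fact_lemma[OF assms] by simp
qed

lemma hermite_coeff_0 [simp]: "hermite_coeff n 0 = 1"
  by (simp add: hermite_coeff_def)

lemma hermite_coeff_eq_0: "n < 2 * k \<Longrightarrow> hermite_coeff n k = 0"
  by (simp add: hermite_coeff_def)

lemma hermite_coeff_Suc:
  "hermite_coeff (n + 2) (Suc k) = hermite_coeff (n + 1) (Suc k) + 2 * (n + 1) * hermite_coeff n k"
proof -
  consider "n < 2 * k" | "n = 2 * k" | j where "n = 2 * k + 1 + j"
    by (metis add.commute add_Suc_right less_imp_add_positive linorder_neqE_nat not_less_eq plus_1_eq_Suc Suc_pred less_iff_Suc_add)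
  then show ?thesis
  proof cases
    case 1 then show ?thesis by (simp add: hermite_coeff_eq_0)
  next
    case 2
    have a: "hermite_coeff (n + 2) (Suc k) * fact (Suc k) = fact (n + 2)"
      using hermite_coeff_mult[of "Suc k" "n + 2"] 2 by simp
    have b: "hermite_coeff n k * fact k = fact n"
      using hermite_coeff_mult[of k n] 2 by simp
    have "hermite_coeff (n + 2) (Suc k) * fact (Suc k) = (2 * (n + 1) * hermite_coeff n k) * fact (Suc k)"
      unfolding a using b 2 by (simp add: algebra_simps)
    then show ?thesis using 2 by (simp add: hermite_coeff_eq_0)
  next
    case (3 j)
    let ?d = "fact (Suc k) * fact (Suc j) :: nat"
    have a: "hermite_coeff (n + 2) (Suc k) * ?d = fact (n + 2)"
      using hermite_coeff_mult[of "Suc k" "n + 2"] 3 by simp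
    have b: "hermite_coeff (n + 1) (Suc k) * (fact (Suc k) * fact j) = fact (n + 1)"
      using hermite_coeff_mult[of "Suc k" "n + 1"] 3 by simp
    have c: "hermite_coeff n k * (fact k * fact (Suc j)) = fact n"
      using hermite_coeff_mult[of k n] 3 by simp
    have "(hermite_coeff (n + 1) (Suc k) + 2 * (n + 1) * hermite_coeff n k) * ?d =
       Suc j * (hermite_coeff (n + 1) (Suc k) * (fact (Suc k) * fact j)) +
       2 * (n + 1) * Suc k * (hermite_coeff n k * (fact k * fact (Suc j)))"
      by (simp add: algebra_simps)
    also have "\<dots> = Suc j * fact (n + 1) + 2 * (n + 1) * Suc k * fact n"
      unfolding b c ..
    also have "\<dots> = fact (n + 2)"
      unfolding 3 by (simp add: algebra_simps)
    finally show ?thesis using a by (metis fact_nonzero mult_cancel2 mult_eq_0_iff)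
  qed
qed

text \<open>
The number of summands is left free because the three members of the recursion have to be
summed over a common range.
\<close>

lemma hermite_form_eq_sum:
  assumes "n < 2 * N"
  shows "hermite_form n w 1 = (\<Sum>k<N. (- 1) ^ k * of_nat (hermite_coeff n k) * w ^ (n - 2 * k))"
  using assms
proof (induction n w "1::'a" arbitrary: N rule: hermite_form.induct)
  case (1 w)
  then obtain M where "N = Suc M" by (cases N) auto
  then show ?case
    by (simp add: sum.lessThan_Suc_shift hermite_coeff_eq_0 del: sum.lessThan_Suc)
next
  case (2 w)
  then obtain M where "N = Suc M" by (cases N) auto
  then show ?case
    by (simp add: sum.lessThan_Suc_shift hermite_coeff_eq_0 del: sum.lessThan_Suc)
next
  case (3 n w)
  then obtain M where N: "N = Suc M" by (cases N) auto
  let ?t = "\<lambda>n k. (- 1) ^ k * of_nat (hermite_coeff n k) * w ^ (n - 2 * k)"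
  have t: "?t (Suc (Suc n)) (Suc k) = w * ?t (Suc n) (Suc k) - 2 * of_nat (Suc n) * ?t n k" for k
  proof -
    have c: "hermite_coeff (Suc (Suc n)) (Suc k) = hermite_coeff (Suc n) (Suc k) + 2 * Suc n * hermite_coeff n k"
      using hermite_coeff_Suc[of n k] by simp
    show ?thesis
    proof (cases "2 * k < n")
      case True
      then obtain j where "n = 2 * k + Suc j" by (metis less_iff_Suc_add add_Suc_right)
      then show ?thesis unfolding c by (simp add: algebra_simps)
    next
      case False
      then have "hermite_coeff (Suc n) (Suc k) = 0" by (simp add: hermite_coeff_eq_0)
      then show ?thesis unfolding c by (simp add: algebra_simps)
    qed
  qed
  have "hermite_form (Suc (Suc n)) w 1 =
      w * (\<Sum>k<Suc M. ?t (Suc n) k) - 2 * of_nat (Suc n) * (\<Sum>k<M. ?t n k)"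
    using 3(1)[of N] 3(2)[of M] 3(3) N by simp
  also have "\<dots> = w * w ^ Suc n + (\<Sum>k<M. w * ?t (Suc n) (Suc k) - 2 * of_nat (Suc n) * ?t n k)"
    by (simp add: sum.lessThan_Suc_shift sum_subtractf sum_distrib_left distrib_left del: sum.lessThan_Suc)
  also have "\<dots> = (\<Sum>k<N. ?t (Suc (Suc n)) k)"
    unfolding t[symmetric] N by (simp add: sum.lessThan_Suc_shift del: sum.lessThan_Suc)
  finally show ?case .
qed

lemma hermite_eq_form: "hermite n = hermite_form n [:0, 2:] 1"
proof -
  have "hermite n = (\<Sum>k<Suc (n div 2). (- 1) ^ k * of_nat (hermite_coeff n k) * [:0, 2:] ^ (n - 2 * k))"
    unfolding hermite_def
  proof (rule sum.cong)
    fix k assume k: "k \<in> {..<Suc (n div 2)}"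
    then have le: "2 * k \<le> n" by auto
    have "(fact n :: int) = of_nat (hermite_coeff n k) * (fact k * fact (n - 2 * k))"
      using arg_cong[OF hermite_coeff_mult[OF le], of int] by simp
    then have "(fact n :: int) div (fact k * fact (n - 2 * k)) = of_nat (hermite_coeff n k)"
      by simp
    then show "smult ((-1) ^ k * (fact n div (fact k * fact (n - 2 * k)))) ([:0, 2:] ^ (n - 2 * k)) =
       (- 1) ^ k * of_nat (hermite_coeff n k) * ([:0, 2:] :: int poly) ^ (n - 2 * k)"
      by (cases "even k") (simp_all add: of_nat_poly)
  qed auto
  also have "\<dots> = hermite_form n [:0, 2:] 1"
    by (rule hermite_form_eq_sum[symmetric]) presburger
  finally show ?thesis .
qed

lemma map_poly_of_int_hermite:
  "map_poly of_int (hermite n) = hermite_form n [:0, 2:] (1 :: 'a :: comm_ring_1 poly)"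
proof -
  have "map_poly of_int (hermite_form n [:0, 2:] 1) = hermite_form n [:0, 2:] (1 :: 'a poly)"
  proof (induction n "[:0, 2:] :: int poly" "1 :: int poly" rule: hermite_form.induct)
    case (3 n)
    have h: "map_poly of_int (p * q) = map_poly of_int p * (map_poly of_int q :: 'a poly)"
       "map_poly of_int (p - q) = map_poly of_int p - (map_poly of_int q :: 'a poly)" for p q :: "int poly"
      by (auto intro!: poly_eqI simp: coeff_map_poly coeff_mult)
    have k: "map_poly of_int (of_nat k :: int poly) = (of_nat k :: 'a poly)"
       "map_poly of_int (numeral a :: int poly) = (numeral a :: 'a poly)" for k a
      by (auto simp: of_nat_poly numeral_poly map_poly_pCons)
    show ?case unfolding hermite_form.simps h 3 k by (simp add: map_poly_pCons)
  qed (simp_all add: map_poly_pCons)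
  then show ?thesis by (simp add: hermite_eq_form)
qed

lemma poly_hermite_form: "poly (hermite_form n p q) x = hermite_form n (poly p x) (poly q x)"
  by (induction n p q rule: hermite_form.induct) (simp_all add: algebra_simps)

text \<open>
By differentiating the recursion.  The derivative of the predecessor is first expressed as
\<open>2 x H\<^sub>m - H\<^sub>m\<^sub>+\<^sub>1\<close>, after which only the recursion itself is needed.
\<close>

lemma pderiv_hermite:
  "pderiv (hermite_form (Suc n) [:0, 2:] 1) =
    (of_nat (2 * Suc n) * hermite_form n [:0, 2:] 1 :: 'a :: idom poly)"
proof (induction n rule: less_induct)
  case (less n)
  show ?case
  proof (cases n)
    case 0 then show ?thesis by (simp add: pderiv_pCons numeral_poly)
  next
    case (Suc m)
    have IH: "pderiv (hermite_form (Suc m) [:0, 2:] 1) = (of_nat (2 * Suc m) * hermite_form m [:0, 2:] 1 :: 'a poly)"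
      using less Suc by simp
    have IH2: "of_nat (Suc m) * pderiv (hermite_form m [:0, 2:] 1) =
        of_nat (Suc m) * ([:0,2:] * hermite_form m [:0, 2:] 1 - hermite_form (Suc m) [:0, 2:] (1::'a poly))"
    proof (cases m)
      case 0 then show ?thesis by simp
    next
      case (Suc k)
      then show ?thesis using less[of k] \<open>n = Suc m\<close>
        by (simp del: hermite_form.simps(3)) (simp add: algebra_simps)
    qed
    have d: "pderiv (2 * of_nat (Suc m) * p) = 2 * of_nat (Suc m) * pderiv p" for p :: "'a poly"
      by (simp only: pderiv_mult pderiv_of_nat pderiv_numeral) simp
    have dX: "pderiv [:0, 2 :: 'a:] = 2" by (simp add: pderiv_pCons numeral_poly)
    have "pderiv (hermite_form (Suc n) [:0, 2:] 1) =
      [:0, 2:] * pderiv (hermite_form (Suc m) [:0, 2:] 1) + 2 * hermite_form (Suc m) [:0, 2:] 1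
       - 2 * (of_nat (Suc m) * pderiv (hermite_form m [:0, 2:] (1 :: 'a poly)))"
      unfolding Suc hermite_form.simps mult_1_right pderiv_diff d unfolding pderiv_mult dX
      by (simp add: algebra_simps del: mult_pCons_left mult_pCons_right)
    also have "\<dots> = of_nat (2 * Suc n) * hermite_form n [:0, 2:] 1"
      unfolding IH IH2 Suc by (simp add: algebra_simps del: mult_pCons_left mult_pCons_right)
    finally show ?thesis .
  qed
qed

section \<open>The discriminant of quasi-Hermite polynomials\<close>
abbreviation hermite_poly :: "nat \<Rightarrow> 'a :: comm_ring_1 poly" where
  "hermite_poly n \<equiv> hermite_form n [:0, 2:] 1"

lemma poly_hermite_poly: "poly (hermite_poly n) x = hermite_form n (2 * x) 1"
  by (simp add: poly_hermite_form mult.commute)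

lemma degree_hermite_poly:
  assumes "(2 :: 'a :: idom) \<noteq> 0"
  shows "degree (hermite_poly n :: 'a poly) = n \<and> lead_coeff (hermite_poly n :: 'a poly) = 2 ^ n"
proof (induction n rule: less_induct)
  case (less n)
  consider "n = 0" | "n = 1" | m where "n = Suc (Suc m)"
    by (metis One_nat_def not0_implies_Suc)
  then show ?case
  proof cases
    case (3 m)
    let ?p = "[:0, 2:] * hermite_poly (Suc m) :: 'a poly"
    let ?q = "2 * of_nat (Suc m) * 1 * hermite_poly m :: 'a poly"
    have nz: "hermite_poly (Suc m) \<noteq> (0 :: 'a poly)"
      using less[of "Suc m"] 3 by (metis degree_0 lessI nat.simps(3))
    have d: "degree ?p = n"
      using less[of "Suc m"] 3 assms nz by (simp add: degree_mult_eq del: mult_pCons_left)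
    have h: "lead_coeff (hermite_poly (Suc m) :: 'a poly) = 2 ^ Suc m"
      using less[of "Suc m"] 3 by blast
    have "lead_coeff ?p = lead_coeff [:0, 2:] * lead_coeff (hermite_poly (Suc m) :: 'a poly)"
      by (rule lead_coeff_mult)
    also have "\<dots> = 2 ^ n"
      unfolding h using assms 3 by simp
    finally have p: "degree ?p = n" "lead_coeff ?p = 2 ^ n"
      using d by blast+
    have "degree ?q = degree (smult (2 * of_nat (Suc m)) (hermite_poly m :: 'a poly))"
      by (simp add: of_nat_poly numeral_poly mult.commute)
    also have "\<dots> \<le> m"
      using less[of m] 3 degree_smult_le by (metis less_Suc_eq lessI)
    finally have q: "degree ?q < n" using 3 by simp
    have "degree (?p + - ?q) = degree ?p"
      by (rule degree_add_eq_left) (simp only: degree_minus p(1) q)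
    then have deg: "degree (?p - ?q) = n"
      by (simp only: diff_conv_add_uminus p(1))
    have "coeff ?p n = 2 ^ n"
      using p(2) unfolding p(1) .
    then have "coeff (?p - ?q) n = 2 ^ n"
      by (simp only: coeff_diff coeff_eq_0[OF q] diff_zero)
    with deg have "degree (?p - ?q) = n \<and> lead_coeff (?p - ?q) = 2 ^ n"
      by simp
    then show ?thesis unfolding 3 hermite_form.simps .
  qed (use assms in simp_all)
qed

lemma quasi_hermite_poly_degree:
  fixes c :: "'a :: idom" and n :: nat
  assumes "(2 :: 'a) \<noteq> 0"
  defines "p \<equiv> hermite_poly (Suc n) + smult c (hermite_poly n) :: 'a poly"
  shows "degree p = Suc n" "lead_coeff p = 2 ^ Suc n"
proof -
  have q: "degree (smult c (hermite_poly n) :: 'a poly) < Suc n"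
    using degree_smult_le[of c "hermite_poly n"] degree_hermite_poly[OF assms(1), of n] by linarith
  then show "degree p = Suc n"
    unfolding p_def using degree_hermite_poly[OF assms(1), of "Suc n"] by (metis degree_add_eq_left)
  then show "lead_coeff p = 2 ^ Suc n"
    using degree_hermite_poly[OF assms(1), of "Suc n"] coeff_eq_0[OF q] unfolding p_def
    by (metis add.right_neutral coeff_add)
qed

text \<open>
Both sides are the resultant of \<open>p\<close> and \<open>q\<close>, written as a product over the roots of either of them.
\<close>

lemma prod_poly_roots_swap:
  fixes f g :: "nat \<Rightarrow> 'a :: comm_ring_1"
  assumes p: "p = smult a (\<Prod>i<n. [:- f i, 1:])" and q: "q = smult b (\<Prod>j<m. [:- g j, 1:])"
  shows "a ^ m * (\<Prod>i<n. poly q (f i)) = (- 1) ^ (n * m) * (b ^ n * (\<Prod>j<m. poly p (g j)))"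
proof -
  let ?R = "\<Prod>i<n. \<Prod>j<m. f i - g j"
  have 1: "(\<Prod>i<n. poly q (f i)) = b ^ n * ?R"
    unfolding q by (simp add: poly_prod prod.distrib)
  have "(\<Prod>j<m. poly p (g j)) = a ^ m * (\<Prod>j<m. \<Prod>i<n. g j - f i)"
    unfolding p by (simp add: poly_prod prod.distrib)
  also have "(\<Prod>j<m. \<Prod>i<n. g j - f i) = (\<Prod>i<n. \<Prod>j<m. - 1 * (f i - g j))"
    by (subst prod.swap) simp
  also have "\<dots> = (- 1) ^ (n * m) * ?R"
    by (simp only: prod.distrib) (simp add: power_mult mult.commute)
  finally have 2: "(\<Prod>j<m. poly p (g j)) = a ^ m * ((- 1) ^ (n * m) * ?R)" .
  have "(- 1) ^ (n * m) * ((- 1) ^ (n * m) * z) = (z :: 'a)" for z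
    by (simp flip: mult.assoc power_add)
  then show ?thesis unfolding 1 2 by (simp add: ac_simps)
qed

lemma alg_closed_split:
  fixes p :: "'a :: alg_closed_field poly"
  assumes "p \<noteq> 0" "degree p = n" "lead_coeff p = a"
  obtains f where "p = smult a (\<Prod>i<n. [:- f i, 1:])"
proof -
  obtain A where A: "size A = degree p" "p = smult (lead_coeff p) (\<Prod>x\<in>#A. [:- x, 1:])"
    using alg_closed_imp_factorization[OF assms(1)] by blast
  obtain as where as: "mset as = A" using ex_mset by blast
  have "(\<Prod>x\<in>#A. [:- x, 1:]) = (\<Prod>a\<leftarrow>as. [:- a, 1:])"
    by (simp add: prod_mset_prod_list flip: as mset_map)
  also have "\<dots> = (\<Prod>i<n. [:- (as ! i), 1:])"
    using A(1) assms(2) by (simp add: prod.list_conv_set_nth atLeast0LessThan flip: as)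
  finally show ?thesis using that A(2) assms(3) by metis
qed

text \<open>
Exchanging the roles of the two polynomials turns the left-hand side into the product of the
values of \<open>p\<close> at the roots of \<open>H\<^sub>n\<close>.  There \<open>p\<close> agrees with \<open>H\<^sub>n\<^sub>+\<^sub>1\<close>, whence the independence
of \<open>c\<close>, and \<open>H\<^sub>n\<^sub>+\<^sub>1\<close> agrees with \<open>- 2 n H\<^sub>n\<^sub>-\<^sub>1\<close>, so that the product reduces to the one
for \<open>n - 1\<close>.  Since \<open>n (n + 1)\<close> is even, the exchange costs no sign, and the powers of the leading
coefficients on the two sides cancel.
\<close>

lemma prod_hermite_at_roots:
  fixes f :: "nat \<Rightarrow> 'a :: alg_closed_field"
  assumes two: "(2 :: 'a) \<noteq> 0"
  assumes "hermite_poly (Suc n) + smult c (hermite_poly n) = smult (2 ^ Suc n) (\<Prod>i<Suc n. [:- f i, 1:])"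
  shows "(\<Prod>i<Suc n. poly (hermite_poly n) (f i)) = (\<Prod>k<Suc n. (- 2 * of_nat k) ^ k)"
  using assms(2)
proof (induction n arbitrary: c f)
  case (Suc n)
  let ?p = "hermite_poly (Suc (Suc n)) + smult c (hermite_poly (Suc n)) :: 'a poly"
  let ?q = "hermite_poly (Suc n) :: 'a poly"
  have q: "degree ?q = Suc n" "lead_coeff ?q = 2 ^ Suc n"
    using degree_hermite_poly[OF two, of "Suc n"] by auto
  then have "?q \<noteq> 0" by (metis degree_0 nat.simps(3))
  then obtain g where g: "?q = smult (2 ^ Suc n) (\<Prod>j<Suc n. [:- g j, 1:])"
    using q by (rule alg_closed_split)
  have "poly ?q (g j) = 0" if "j < Suc n" for j
    unfolding g using that by (auto simp: poly_prod simp del: prod.lessThan_Suc intro!: prod_zero)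
  then have pg: "poly ?p (g j) = (- 2 * of_nat (Suc n)) * poly (hermite_poly n) (g j)" if "j < Suc n" for j
    using that unfolding hermite_form.simps by (simp add: algebra_simps)
  have "(2 ^ Suc (Suc n)) ^ Suc n * (\<Prod>i<Suc (Suc n). poly ?q (f i)) =
     (- 1) ^ (Suc (Suc n) * Suc n) * ((2 ^ Suc n) ^ Suc (Suc n) * (\<Prod>j<Suc n. poly ?p (g j)))"
    by (rule prod_poly_roots_swap[OF Suc.prems g])
  also have "(- 1 :: 'a) ^ (Suc (Suc n) * Suc n) = 1"
    by (rule neg_one_even_power) simp
  also have "(\<Prod>j<Suc n. poly ?p (g j)) =
      (- 2 * of_nat (Suc n)) ^ Suc n * (\<Prod>j<Suc n. poly (hermite_poly n) (g j))"
    using pg by (subst prod.cong[OF refl, of _ _ "\<lambda>j. (- 2 * of_nat (Suc n)) * poly (hermite_poly n) (g j)"])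
      (auto simp: prod.distrib simp del: prod.lessThan_Suc)
  also have "(\<Prod>j<Suc n. poly (hermite_poly n) (g j)) = (\<Prod>k<Suc n. (- 2 * of_nat k) ^ k)"
    by (rule Suc.IH[of 0]) (use g in simp)
  also have "((2::'a) ^ Suc n) ^ Suc (Suc n) = (2 ^ Suc (Suc n)) ^ Suc n"
    by (simp only: power_mult[symmetric] mult.commute)
  finally have "(\<Prod>i<Suc (Suc n). poly ?q (f i)) =
      (- 2 * of_nat (Suc n)) ^ Suc n * (\<Prod>k<Suc n. (- 2 * of_nat k) ^ k)"
    using power_not_zero[OF power_not_zero[OF two]] by (simp only: mult_1_left mult_cancel_left) blast
  then show ?case by (simp only: prod.lessThan_Suc[of _ "Suc n"] mult.commute)
qed simp

text \<open>
For \<open>c \<noteq> 0\<close> the product is, up to powers of \<open>c\<close> and 2, the value of the polynomial at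
\<open>- w / (2 c)\<close>, and homogeneity of the Hermite forms absorbs the powers of \<open>c\<close>.
\<close>

lemma prod_linear_at_roots:
  fixes f :: "nat \<Rightarrow> 'a :: field"
  assumes two: "(2 :: 'a) \<noteq> 0"
  assumes p: "hermite_poly (Suc n) + smult c (hermite_poly n) = smult (2 ^ Suc n) (\<Prod>i<Suc n. [:- f i, 1:])"
  shows "(\<Prod>i<Suc n. 2 * c * f i + w) = hermite_form (Suc n) w (c\<^sup>2) - c\<^sup>2 * hermite_form n w (c\<^sup>2)"
proof (cases "c = 0")
  case True
  then show ?thesis by (simp add: hermite_form_zero)
next
  case False
  define t where "t = - (w / (2 * c))"
  have w: "w = - c * (2 * t)" using two False by (simp add: t_def)
  have "(\<Prod>i<Suc n. 2 * c * f i + w) = (\<Prod>i<Suc n. (- 2 * c) * (t - f i))"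
    unfolding w by (simp add: algebra_simps)
  also have "\<dots> = (- c) ^ Suc n * (2 ^ Suc n * (\<Prod>i<Suc n. t - f i))"
    by (simp only: prod.distrib prod_constant card_lessThan power_mult_distrib[symmetric] mult.assoc[symmetric])
       (simp add: mult.commute)
  also have "2 ^ Suc n * (\<Prod>i<Suc n. t - f i) = poly (hermite_poly (Suc n) + smult c (hermite_poly n)) t"
    unfolding p by (simp add: poly_prod del: prod.lessThan_Suc)
  also have "\<dots> = hermite_form (Suc n) (2 * t) 1 + c * hermite_form n (2 * t) 1"
    by (simp only: poly_add poly_smult poly_hermite_poly)
  also have "(- c) ^ Suc n * \<dots> = (- c) ^ Suc n * hermite_form (Suc n) (2 * t) 1 -
      c\<^sup>2 * ((- c) ^ n * hermite_form n (2 * t) 1)"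
    by (simp add: algebra_simps power2_eq_square del: hermite_form.simps)
  also have "\<dots> = hermite_form (Suc n) w (c\<^sup>2) - c\<^sup>2 * hermite_form n w (c\<^sup>2)"
    using hermite_form_scale[of "Suc n" "- c" "2 * t" 1] hermite_form_scale[of n "- c" "2 * t" 1]
    by (simp only: w[symmetric] mult_1_right power2_minus)
  finally show ?thesis .
qed

lemma pderiv_hermite_poly:
  "pderiv (hermite_poly n) = ([:0, 2:] * hermite_poly n - hermite_poly (Suc n) :: 'a :: idom poly)"
  by (cases n) (simp_all add: pderiv_hermite algebra_simps del: mult_pCons_left)

lemma poly_pderiv_quasi_hermite:
  fixes x :: "'a :: idom"
  assumes "poly (hermite_poly (Suc n) + smult c (hermite_poly n)) x = 0"
  shows "poly (pderiv (hermite_poly (Suc n) + smult c (hermite_poly n))) x =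
    (2 * c * x + (2 * of_nat (Suc n) + c\<^sup>2)) * poly (hermite_poly n) x"
proof -
  have "poly (hermite_poly (Suc n)) x = - c * poly (hermite_poly n) x"
    using assms by (simp add: add_eq_0_iff2 del: hermite_form.simps)
  then show ?thesis
    unfolding pderiv_add pderiv_smult pderiv_hermite unfolding pderiv_hermite_poly
    by (simp add: algebra_simps power2_eq_square del: hermite_form.simps)
qed

lemma prod_neg_one_pairs:
  "(\<Prod>(i, j) \<in> {(i, j). i < j \<and> j < n}. (- 1 :: 'a :: comm_ring_1)) = (\<Prod>k<n. (- 1) ^ k)"
proof -
  have "(\<Prod>k<n. (- 1 :: 'a) ^ k) = (\<Prod>k<n. \<Prod>i<k. - 1)" by simp
  also have "\<dots> = (\<Prod>(k, i)\<in>Sigma {..<n} lessThan. - 1)"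
    by (rule prod.Sigma) auto
  also have "\<dots> = (\<Prod>(i, j) \<in> {(i, j). i < j \<and> j < n}. - 1)"
    by (rule prod.reindex_bij_witness[of _ prod.swap prod.swap]) auto
  finally show ?thesis ..
qed

text \<open>
By the product rule, \<open>p'(\<alpha>\<^sub>i)\<close> is \<open>a\<close> times the product of all \<open>\<alpha>\<^sub>i - \<alpha>\<^sub>j\<close> with \<open>j \<noteq> i\<close>.  The sign
\<open>(- 1)\<^bsup>n(n-1)/2\<^esup>\<close> from pairing \<open>(i, j)\<close> with \<open>(j, i)\<close> is kept as a product of \<open>(- 1)\<^sup>k\<close>,
the form in which it cancels against the factors \<open>(- 2 k)\<^sup>k\<close> of \<open>prod_hermite_at_roots\<close>.
\<close>

lemma prod_pderiv_at_roots:
  fixes f :: "nat \<Rightarrow> 'a :: idom"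
  assumes p: "p = smult a (\<Prod>i<n. [:- f i, 1:])"
  shows "(\<Prod>i<n. poly (pderiv p) (f i)) =
    a ^ n * ((\<Prod>k<n. (- 1) ^ k) * (\<Prod>(i, j) \<in> {(i, j). i < j \<and> j < n}. (f i - f j)\<^sup>2))"
proof -
  have "poly (pderiv p) (f i) = a * (\<Prod>j\<in>{..<n} - {i}. f i - f j)" if i: "i < n" for i
  proof -
    have "poly (pderiv p) (f i) = a * (\<Sum>k<n. (\<Prod>j\<in>{..<n} - {k}. f i - f j))"
      unfolding p by (simp add: pderiv_smult pderiv_prod poly_sum poly_prod pderiv_pCons)
    also have "(\<Sum>k<n. (\<Prod>j\<in>{..<n} - {k}. f i - f j)) =
        (\<Sum>k<n. if k = i then (\<Prod>j\<in>{..<n} - {i}. f i - f j) else 0)"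
      by (rule sum.cong) (use i in \<open>auto intro!: prod_zero\<close>)
    finally show ?thesis using i by simp
  qed
  then have "(\<Prod>i<n. poly (pderiv p) (f i)) = a ^ n * (\<Prod>i<n. \<Prod>j\<in>{..<n} - {i}. f i - f j)"
    by (simp add: prod.distrib)
  also have "(\<Prod>i<n. \<Prod>j\<in>{..<n} - {i}. f i - f j) =
      (\<Prod>(i, j)\<in>Sigma {..<n} (\<lambda>i. {..<n} - {i}). f i - f j)"
    by (rule prod.Sigma) auto
  also have "Sigma {..<n} (\<lambda>i. {..<n} - {i}) = {(i, j). i < n \<and> j < n \<and> i \<noteq> j}" by auto
  finally show ?thesis
    unfolding prod_offdiag_eq prod_neg_one_pairs .
qed

lemma discriminant_eq_prod_pderiv:
  fixes p :: "'a :: field poly"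
  assumes "degree p = n" "n \<ge> 2" and a: "to_ac (lead_coeff p) = a" and q: "map_poly to_ac p = q"
    and f: "q = smult a (\<Prod>i<n. [:- f i, 1:])"
  shows "discriminant p = a ^ (n - 2) * ((\<Prod>k<n. (- 1) ^ k) * (\<Prod>i<n. poly (pderiv q) (f i)))"
proof -
  let ?s = "\<Prod>k<n. (- 1 :: 'a alg_closure) ^ k"
  let ?D = "\<Prod>(i, j) \<in> {(i, j). i < j \<and> j < n}. (f i - f j)\<^sup>2"
  have "p \<noteq> 0" using assms by auto
  have "is_root_list p (map f [0..<n])"
    unfolding is_root_list_def q a f
    by (simp add: prod.list_conv_set_nth atLeast0LessThan)
  then have "discriminant p = a ^ (2 * n - 2) *
      (\<Prod>(i, j) \<in> {(i, j). i < j \<and> j < n}. (map f [0..<n] ! i - map f [0..<n] ! j)\<^sup>2)"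
    using discriminant_eq[OF \<open>p \<noteq> 0\<close>] assms(1) a by simp
  also have "(\<Prod>(i, j) \<in> {(i, j). i < j \<and> j < n}. (map f [0..<n] ! i - map f [0..<n] ! j)\<^sup>2) = ?D"
    by (rule prod.cong) auto
  also have "2 * n - 2 = (n - 2) + n" using assms by simp
  also have "a ^ \<dots> * ?D = a ^ (n - 2) * ((?s * ?s) * (a ^ n * ?D))"
    by (simp add: power_add mult.assoc flip: prod.distrib power_mult_distrib)
  also have "\<dots> = a ^ (n - 2) * (?s * (a ^ n * (?s * ?D)))"
    by (simp only: ac_simps)
  finally show ?thesis unfolding prod_pderiv_at_roots[OF f] .
qed

text \<open>
The part of the discriminant of \<open>H\<^sub>n + c H\<^sub>n\<^sub>-\<^sub>1\<close> that depends on \<open>c\<close>, as a function of \<open>s = c\<^sup>2\<close>.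
\<close>

definition disc_factor :: "nat \<Rightarrow> 'a :: comm_ring_1 \<Rightarrow> 'a" where
  "disc_factor n s = of_nat n * hermite_form (n - 1) (2 * of_nat n + s) s
     - of_nat (n - 1) * s * hermite_form (n - 2) (2 * of_nat n + s) s"

text \<open>
Here \<open>w - s = 2 n\<close>, so after one step of the recursion everything is divisible by 2.
\<close>

lemma two_disc_factor:
  assumes "n \<ge> 2"
  shows "hermite_form n (2 * of_nat n + s) s - s * hermite_form (n - 1) (2 * of_nat n + s) s =
    2 * disc_factor n s"
proof -
  obtain m where m: "n = Suc (Suc m)" using assms by (metis Suc_le_D numeral_2_eq_2 Suc_le_mono)
  define w where "w = 2 * of_nat n + s"
  have "(w - s) * a - 2 * b = 2 * (of_nat n * a - b)" for a b
    by (simp add: w_def algebra_simps)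
  from this[of "hermite_form (Suc m) w s" "of_nat (Suc m) * s * hermite_form m w s"]
  show ?thesis unfolding disc_factor_def w_def[symmetric] unfolding m
    by (simp add: algebra_simps)
qed

lemma hermite_form_to_ac: "to_ac (hermite_form n w s) = hermite_form n (to_ac w) (to_ac s)"
  by (induction n w s rule: hermite_form.induct)
     (simp_all)

lemma disc_factor_to_ac: "to_ac (disc_factor n s) = disc_factor n (to_ac s)"
  by (simp add: disc_factor_def hermite_form_to_ac)

text \<open>
For \<open>c = 0\<close> this is Schur's formula for the discriminant of \<open>H\<^sub>n\<close>.
\<close>

theorem discriminant_quasi_hermite:
  fixes c :: "'a :: field"
  assumes two: "(2 :: 'a) \<noteq> 0" and n: "n \<ge> 2"
  shows "discriminant (map_poly of_int (hermite n) + smult c (map_poly of_int (hermite (n - 1)))) =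
    to_ac (2 ^ (n * (n - 2)) * (\<Prod>k<n. (2 * of_nat k) ^ k) * (2 * disc_factor n (c\<^sup>2)))"
proof -
  obtain m where m: "n = Suc (Suc m)" using n by (metis Suc_le_D numeral_2_eq_2 Suc_le_mono)
  let ?c = "to_ac c" and ?n = "of_nat n :: 'a alg_closure"
  define p where "p = hermite_poly n + smult c (hermite_poly (n - 1))"
  define P where "P = hermite_poly n + smult ?c (hermite_poly (n - 1))"
  have two': "(2 :: 'a alg_closure) \<noteq> 0" using two by (metis to_ac_eq_0_iff to_ac_numeral)
  have deg: "degree p = n" "lead_coeff p = 2 ^ n"
    using quasi_hermite_poly_degree[OF two, of "Suc m" c] unfolding p_def m by simp_all
  have deg': "degree P = n" "lead_coeff P = 2 ^ n"
    using quasi_hermite_poly_degree[OF two', of "Suc m" ?c] unfolding P_def m by simp_all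
  have P: "map_poly to_ac p = P"
  proof -
    have *: "map_poly to_ac (map_poly of_int q :: 'a poly) = (map_poly of_int q :: 'a alg_closure poly)"
      for q by (intro poly_eqI) (simp add: coeff_map_poly)
    have "map_poly to_ac (hermite_poly k :: 'a poly) = hermite_poly k" for k
      using *[of "hermite k"] by (simp add: map_poly_of_int_hermite)
    moreover have "map_poly to_ac (q + smult c r) = map_poly to_ac q + smult ?c (map_poly to_ac r)" for q r :: "'a poly"
      by (intro poly_eqI) (simp add: coeff_map_poly)
    ultimately show ?thesis unfolding p_def P_def by simp
  qed
  have "P \<noteq> 0" using deg'(1) m by auto
  then obtain f where f: "P = smult (2 ^ n) (\<Prod>i<n. [:- f i, 1:])"
    using deg' by (rule alg_closed_split)
  have f': "hermite_poly (Suc (Suc m)) + smult ?c (hermite_poly (Suc m)) =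
      smult (2 ^ Suc (Suc m)) (\<Prod>i<Suc (Suc m). [:- f i, 1:])"
    using f unfolding P_def m diff_Suc_1 .
  have "poly P (f i) = 0" if "i < n" for i
    unfolding f using that by (auto simp: poly_prod intro!: prod_zero)
  then have dP: "poly (pderiv P) (f i) = (2 * ?c * f i + (2 * ?n + ?c\<^sup>2)) * poly (hermite_poly (n - 1)) (f i)"
    if "i < n" for i
    using poly_pderiv_quasi_hermite[of "n - 1" ?c "f i"] that unfolding P_def m by (simp del: hermite_form.simps of_nat_Suc)
  have "discriminant p = (2 ^ n) ^ (n - 2) * ((\<Prod>k<n. (- 1) ^ k) * (\<Prod>i<n. poly (pderiv P) (f i)))"
    by (rule discriminant_eq_prod_pderiv[OF deg(1) n _ P f]) (simp only: deg(2) to_ac_power to_ac_numeral)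
  also have "(\<Prod>i<n. poly (pderiv P) (f i)) =
     (\<Prod>i<n. 2 * ?c * f i + (2 * ?n + ?c\<^sup>2)) * (\<Prod>i<n. poly (hermite_poly (n - 1)) (f i))"
    using dP by (simp flip: prod.distrib)
  also have "(\<Prod>i<n. poly (hermite_poly (n - 1)) (f i)) = (\<Prod>k<n. (- 2 * of_nat k) ^ k)"
    using prod_hermite_at_roots[OF two' f'] unfolding m diff_Suc_1 .
  also have "(\<Prod>i<n. 2 * ?c * f i + (2 * ?n + ?c\<^sup>2)) = 2 * disc_factor n (?c\<^sup>2)"
    using prod_linear_at_roots[OF two' f', of "2 * ?n + ?c\<^sup>2"] two_disc_factor[OF n, of "?c\<^sup>2"]
    unfolding m diff_Suc_1 by (rule trans)
  also have "(\<Prod>k<n. (- 1) ^ k) * (2 * disc_factor n (?c\<^sup>2) * (\<Prod>k<n. (- 2 * of_nat k) ^ k)) =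
     (\<Prod>k<n. (2 * of_nat k) ^ k) * (2 * disc_factor n (?c\<^sup>2))"
  proof -
    have "(\<Prod>k<n. (2 * of_nat k :: 'a alg_closure) ^ k) = (\<Prod>k<n. (- 1) ^ k * (- 2 * of_nat k) ^ k)"
      unfolding power_mult_distrib[symmetric] by simp
    then show ?thesis by (simp only: prod.distrib ac_simps)
  qed
  finally have "discriminant p = to_ac (2 ^ (n * (n - 2)) * (\<Prod>k<n. (2 * of_nat k) ^ k) * (2 * disc_factor n (c\<^sup>2)))"
    unfolding power_mult[symmetric] mult.assoc to_ac_mult to_ac_power to_ac_prod to_ac_of_nat to_ac_numeral disc_factor_to_ac .
  then show ?thesis
    unfolding p_def map_poly_of_int_hermite .
qed

section \<open>Square classes of 2-adic numbers\<close>
lemma residue_add: "residue (x + y) n = (residue x n + residue y n) mod 2 ^ n"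
  by (simp add: plus_two_adic_int.rep_eq)

lemma residue_mult: "residue (x * y) n = (residue x n * residue y n) mod 2 ^ n"
  by (simp add: times_two_adic_int.rep_eq)

lemma residue_mod_self [simp]: "residue x n mod 2 ^ n = residue x n"
  using residue_mod[of x n 0] by simp

lemma residue_diff: "residue (x - y) n = (residue x n - residue y n) mod 2 ^ n"
  by (simp only: diff_conv_add_uminus plus_two_adic_int.rep_eq uminus_two_adic_int.rep_eq mod_add_right_eq)

lemma residue_of_nat: "residue (of_nat k) n = int k mod 2 ^ n"
  by (induction k) (simp_all add: residue_add zero_two_adic_int.rep_eq one_two_adic_int.rep_eq mod_simps)

lemma residue_numeral: "residue (numeral k) n = numeral k mod 2 ^ n"
  using residue_of_nat[of "numeral k" n] by simp

lemma residue_power: "residue (x ^ k) n = residue x n ^ k mod 2 ^ n"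
  by (induction k) (simp_all add: residue_mult one_two_adic_int.rep_eq mod_simps)

lemma residue_mod_two: "n > 0 \<Longrightarrow> residue x n mod 2 = residue x 1"
  using residue_mod[of x 1 "n - 1"] by simp

lemma residue_1_cases: "residue x 1 = 0 \<or> residue x 1 = 1"
  using residue_mod_self[of x 1] by simp presburger

text \<open>
Dividing by 2 shifts the sequence of residues: half of \<open>x\<close> modulo \<open>2\<^sup>n\<close> is determined by \<open>x\<close>
modulo \<open>2\<^bsup>n+1\<^esup>\<close>.
\<close>

lemma residue_1_eq_0E:
  assumes "residue x 1 = 0"
  obtains y where "x = 2 * y" "\<And>n. residue y n = residue x (Suc n) div 2"
proof -
  define y where "y = Abs_two_adic_int (\<lambda>n. residue x (Suc n) div 2)"
  have "residue x (Suc (Suc n)) div 2 mod 2 ^ n = residue x (Suc n) div 2" for n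
  proof -
    have "residue x (Suc n) = residue x (Suc (Suc n)) mod (2 * 2 ^ n)"
      using residue_mod[of x "Suc n" 1] by simp
    also have "\<dots> = 2 * (residue x (Suc (Suc n)) div 2 mod 2 ^ n) + residue x (Suc (Suc n)) mod 2"
      by (rule zmod_zmult2_eq) simp
    finally show ?thesis by simp
  qed
  then have y: "residue y n = residue x (Suc n) div 2" for n
    unfolding y_def by (subst Abs_two_adic_int_inverse) auto
  have "residue x n = residue (2 * y) n" for n
  proof -
    have "residue x (Suc n) mod 2 = 0" using residue_mod_two[of "Suc n" x] assms by simp
    then have "2 * (residue x (Suc n) div 2) = residue x (Suc n)" by presburger
    then show ?thesis
      using residue_mod[of x n 1] by (simp add: residue_mult residue_numeral y mod_simps)
  qed
  then have "x = 2 * y" by (simp add: residue_inject[symmetric] fun_eq_iff)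
  then show ?thesis using that y by blast
qed

lemma two_adic_int_odd_part:
  assumes "x \<noteq> 0"
  obtains k u where "x = 2 ^ k * u" "residue u 1 = 1"
proof -
  obtain i where "residue x i \<noteq> 0"
    using assms by (metis ext residue_inject zero_two_adic_int.rep_eq)
  then have "\<exists>k u. x = 2 ^ k * u \<and> residue u 1 = 1"
  proof (induction i arbitrary: x)
    case 0
    then show ?case using residue_mod_self[of x 0] by simp
  next
    case (Suc i)
    show ?case
    proof (cases "residue x 1 = 0")
      case True
      then obtain y where y: "x = 2 * y" "\<And>n. residue y n = residue x (Suc n) div 2"
        by (rule residue_1_eq_0E) blast
      have "residue x (Suc i) mod 2 = 0" using residue_mod_two[of "Suc i" x] True by simp
      then have "residue y i \<noteq> 0" using Suc.prems y(2)[of i] by presburger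
      then obtain k u where "y = 2 ^ k * u" "residue u 1 = 1" using Suc.IH by blast
      then have "x = 2 ^ Suc k * u" "residue u 1 = 1" using y by (simp_all add: mult.assoc)
      then show ?thesis by blast
    next
      case False
      then show ?thesis using residue_1_cases[of x] by (intro exI[of _ 0] exI[of _ x]) simp
    qed
  qed
  then show ?thesis using that by blast
qed

text \<open>
The inverses modulo \<open>2\<^sup>n\<close> are unique in \<open>{0..<2\<^sup>n}\<close>, hence compatible with each other.
\<close>

lemma two_adic_int_odd_unit:
  assumes "residue u 1 = 1"
  obtains v where "u * v = 1"
proof -
  have "\<exists>x. x mod 2 ^ n = x \<and> residue u n * x mod 2 ^ n = 1 mod 2 ^ n" for n
  proof -
    have "coprime (residue u n) (2 ^ n)"
    proof (cases "n = 0")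
      case False
      then have "odd (residue u n)" using residue_mod_two[of n u] assms by presburger
      then show ?thesis by simp
    qed simp
    then obtain x y where "x * residue u n + y * 2 ^ n = 1"
      using bezout_int[of "residue u n" "2 ^ n"] by auto
    then have "residue u n * x = 1 - y * 2 ^ n" by (simp add: algebra_simps)
    then have "residue u n * x mod 2 ^ n = 1 mod 2 ^ n"
      using mod_mult_self1[of 1 "- y" "2 ^ n"] by simp
    then show ?thesis by (intro exI[of _ "x mod 2 ^ n"]) (simp add: mod_simps)
  qed
  then obtain v where v: "\<And>n. v n mod 2 ^ n = v n" "\<And>n. residue u n * v n mod 2 ^ n = 1 mod 2 ^ n"
    by metis
  have "v (Suc n) mod 2 ^ n = v n" for n
  proof -
    have 1: "residue u n * v (Suc n) mod 2 ^ n = 1 mod 2 ^ n"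
    proof -
      have "residue u n * v (Suc n) mod 2 ^ n = residue u (Suc n) * v (Suc n) mod 2 ^ n"
        using residue_mod[of u n 1] by (metis Suc_eq_plus1 mod_mult_left_eq)
      also have "\<dots> = residue u (Suc n) * v (Suc n) mod 2 ^ Suc n mod 2 ^ n"
        by (rule mod_mod_two_power_Suc[symmetric])
      also have "\<dots> = 1 mod 2 ^ n"
        unfolding v by (rule mod_mod_two_power_Suc)
      finally show ?thesis .
    qed
    have "v (Suc n) mod 2 ^ n = (residue u n * v n mod 2 ^ n) * v (Suc n) mod 2 ^ n"
      unfolding v by (simp add: mod_simps)
    also have "\<dots> = (residue u n * v (Suc n) mod 2 ^ n) * v n mod 2 ^ n"
      by (simp add: mod_simps ac_simps)
    also have "\<dots> = v n"
      unfolding 1 using v(1)[of 0] v(1)[of n] by (simp add: mod_simps)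
    finally show ?thesis .
  qed
  then have r: "residue (Abs_two_adic_int v) n = v n" for n
    by (subst Abs_two_adic_int_inverse) auto
  have "u * Abs_two_adic_int v = 1"
    by (simp add: residue_inject[symmetric] fun_eq_iff residue_mult one_two_adic_int.rep_eq r v)
  then show ?thesis using that by blast
qed

lemma residue_square:
  assumes "residue u 1 = 1"
  shows "residue (u\<^sup>2) 3 = 1"
proof -
  have "residue u 3 mod 2 = 1" using residue_mod_two[of 3 u] assms by simp
  then have "(residue u 3 mod 8) \<in> {1, 3, 5, 7}" by simp presburger
  then have "(residue u 3 mod 8)\<^sup>2 mod 8 = 1" by auto
  then show ?thesis by (simp add: residue_power mod_simps)
qed

lemma two_power_odd_unique:
  assumes "2 ^ i * p = 2 ^ j * q" "residue p 1 = 1" "residue q 1 = 1"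
  shows "i = j" "p = q"
proof -
  have two: "(2 :: two_adic_int) \<noteq> 0"
    using residue_numeral[of "num.Bit0 num.One" 2] by (auto simp: zero_two_adic_int.rep_eq)
  have aux: "\<not> i < j" if "2 ^ i * p = 2 ^ j * q" "residue p 1 = 1" for i j p q
  proof
    assume "i < j"
    then obtain k where "j = i + Suc k" by (metis less_imp_Suc_add add_Suc_right)
    then have "p = 2 * (2 ^ k * q)" using that(1) two by (simp add: power_add mult.assoc)
    then show False using that(2) by (simp add: residue_mult residue_numeral)
  qed
  show "i = j" using aux[OF assms(1,2)] aux[OF assms(1)[symmetric] assms(3)] by simp
  then show "p = q" using assms(1) two by simp
qed

lemma residue_mult_odd: "residue x 1 = 1 \<Longrightarrow> residue y 1 = 1 \<Longrightarrow> residue (x * y) 1 = 1"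
  by (simp add: residue_mult)

text \<open>
Comparing the powers of 2 on both sides leaves an equation between odd numbers, and squares of
odd numbers are congruent to 1 modulo 8.
\<close>

lemma odd_part_of_square:
  assumes "y\<^sup>2 = 2 ^ e * u * z\<^sup>2" "z \<noteq> 0" "residue u 1 = 1"
  shows "even e" "residue u 3 = 1"
proof -
  obtain l w where z: "z = 2 ^ l * w" "residue w 1 = 1"
    using two_adic_int_odd_part[OF assms(2)] .
  have "u \<noteq> 0" using assms(3) by (auto simp: zero_two_adic_int.rep_eq)
  moreover have two: "(2 :: two_adic_int) \<noteq> 0"
    using residue_numeral[of "num.Bit0 num.One" 2] by (auto simp: zero_two_adic_int.rep_eq)
  ultimately have "y \<noteq> 0" using assms(1,2) by auto
  then obtain k v where y: "y = 2 ^ k * v" "residue v 1 = 1"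
    using two_adic_int_odd_part by blast
  have "2 ^ (2 * k) * v\<^sup>2 = 2 ^ (e + 2 * l) * (u * w\<^sup>2)"
    using assms(1) unfolding y z by (simp add: power_mult_distrib power_mult power_add algebra_simps flip: power_mult)
  moreover have "residue (v\<^sup>2) 1 = 1" "residue (u * w\<^sup>2) 1 = 1"
    unfolding power2_eq_square by (intro residue_mult_odd y(2) z(2) assms(3))+
  ultimately have "2 * k = e + 2 * l" "v\<^sup>2 = u * w\<^sup>2"
    using two_power_odd_unique by blast+
  then show "even e" by presburger
  have "residue (u * w\<^sup>2) 3 = residue u 3"
    using residue_square[OF z(2)] residue_mod_self[of u 3] by (simp add: residue_mult)
  then show "residue u 3 = 1"
    using residue_square[OF y(2)] \<open>v\<^sup>2 = u * w\<^sup>2\<close> by simp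
qed

text \<open>
For odd \<open>r\<close> this describes the class of \<open>x\<close> modulo nonzero squares; only \<open>e mod 2\<close> and \<open>r mod 8\<close>
matter.  A general \<open>e\<close> and an unreduced \<open>r\<close> make products of classes simple.
\<close>

definition in_square_class :: "nat \<Rightarrow> int \<Rightarrow> two_adic \<Rightarrow> bool" where
  "in_square_class e r x \<longleftrightarrow> (\<exists>u z. z \<noteq> 0 \<and> x = 2 ^ e * to_fract u * z\<^sup>2 \<and> residue u 3 = r mod 8)"

lemma in_square_class_mod: "in_square_class e (r mod 8) x \<longleftrightarrow> in_square_class e r x"
  by (simp add: in_square_class_def)

lemma to_fract_power: "to_fract (x ^ n) = to_fract x ^ n"
  by (induction n) simp_all

lemma to_fract_of_nat: "to_fract (of_nat k) = of_nat k"
  by (induction k) simp_all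

lemma to_fract_numeral: "to_fract (numeral k) = numeral k"
  using to_fract_of_nat[of "numeral k"] by simp

lemma two_adic_two_nonzero: "(2 :: two_adic) \<noteq> 0"
proof -
  have "(2 :: two_adic_int) \<noteq> 0"
    using residue_numeral[of "num.Bit0 num.One" 2] by (auto simp: zero_two_adic_int.rep_eq)
  then show ?thesis by (metis to_fract_eq_0_iff to_fract_numeral)
qed

lemma two_adic_of_nat_nonzero: "k > 0 \<Longrightarrow> (of_nat k :: two_adic) \<noteq> 0"
proof -
  assume k: "k > 0"
  have "residue (of_nat k) k = int k"
    unfolding residue_of_nat using of_nat_less_two_power[of k] by (intro mod_pos_pos_trivial) auto
  then have "(of_nat k :: two_adic_int) \<noteq> 0" using k by (auto simp: zero_two_adic_int.rep_eq)
  then show ?thesis by (metis to_fract_eq_0_iff to_fract_of_nat)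
qed

lemma in_square_class_square:
  assumes "in_square_class e r (y\<^sup>2)" "odd r"
  shows "even e \<and> r mod 8 = 1"
proof -
  obtain u z where z: "z \<noteq> 0" "y\<^sup>2 = 2 ^ e * to_fract u * z\<^sup>2" "residue u 3 = r mod 8"
    using assms unfolding in_square_class_def by blast
  obtain a b where y: "y = Fract a b" "b \<noteq> 0" by (cases y)
  obtain c d where zf: "z = Fract c d" "d \<noteq> 0" by (cases z)
  have c: "c \<noteq> 0" using z(1) zf by (auto simp: Zero_fract_def eq_fract)
  have "to_fract (a * d) = y * to_fract (b * d)" "to_fract (c * b) = z * to_fract (b * d)"
    unfolding y zf to_fract_def using y(2) zf(2) by (simp_all add: eq_fract)
  then have "to_fract (a * d) ^ 2 = 2 ^ e * to_fract u * to_fract (c * b) ^ 2"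
    by (simp only: power_mult_distrib z(2) mult.assoc)
  then have "to_fract ((a * d)\<^sup>2) = to_fract (2 ^ e * u * (c * b)\<^sup>2)"
    by (simp only: to_fract_power to_fract_numeral to_fract_mult)
  then have eq: "(a * d)\<^sup>2 = 2 ^ e * u * (c * b)\<^sup>2" by (simp only: to_fract_eq_iff)
  have "residue u 1 = residue u 3 mod 2" by (simp add: residue_mod_two)
  also have "\<dots> = 1" using z(3) assms(2) by simp presburger
  finally have u: "residue u 1 = 1" .
  have "c * b \<noteq> 0" using c y by simp
  from odd_part_of_square[OF eq this u] z(3) show ?thesis by simp
qed

lemma in_square_class_mult:
  assumes "in_square_class e r x" "in_square_class f s y"
  shows "in_square_class (e + f) (r * s) (x * y)"
proof -
  obtain u z where z: "z \<noteq> 0" "x = 2 ^ e * to_fract u * z\<^sup>2" "residue u 3 = r mod 8"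
    using assms unfolding in_square_class_def by blast
  obtain v t where t: "t \<noteq> 0" "y = 2 ^ f * to_fract v * t\<^sup>2" "residue v 3 = s mod 8"
    using assms unfolding in_square_class_def by blast
  have "x * y = 2 ^ (e + f) * to_fract (u * v) * (z * t)\<^sup>2"
    unfolding z t by (simp add: power_add power_mult_distrib ac_simps)
  moreover have "residue (u * v) 3 = (r * s) mod 8"
    by (simp add: residue_mult z t mod_simps)
  moreover have "z * t \<noteq> 0" using z t by simp
  ultimately show ?thesis unfolding in_square_class_def by blast
qed

lemma in_square_class_integer: "in_square_class e (residue u 3) (to_fract (2 ^ e * u))"
  unfolding in_square_class_def
  using residue_mod_self[of u 3] by (intro exI[of _ u] exI[of _ 1]) (simp add: to_fract_power to_fract_numeral)

lemma in_square_class_nonzero_square: "z \<noteq> 0 \<Longrightarrow> in_square_class 0 1 (z\<^sup>2)"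
  unfolding in_square_class_def by (intro exI[of _ 1] exI[of _ z]) (simp add: one_two_adic_int.rep_eq)

text \<open>
A 2-adic number is an integer or the inverse of an even integer.
\<close>

lemma two_adic_cases:
  fixes c :: two_adic
  obtains x where "c = to_fract x" | x where "c * to_fract (2 * x) = 1"
proof (cases "c = 0")
  case True
  then show ?thesis using that(1)[of 0] by simp
next
  case False
  obtain a b where c: "c = Fract a b" "b \<noteq> 0" by (cases c)
  have "a \<noteq> 0" using False c by (auto simp: Zero_fract_def eq_fract)
  then obtain k u where a: "a = 2 ^ k * u" "residue u 1 = 1" using two_adic_int_odd_part by blast
  obtain l v where b: "b = 2 ^ l * v" "residue v 1 = 1" using two_adic_int_odd_part[OF c(2)] .
  obtain u' where u': "u * u' = 1" using two_adic_int_odd_unit[OF a(2)] .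
  obtain v' where v': "v * v' = 1" using two_adic_int_odd_unit[OF b(2)] .
  show ?thesis
  proof (cases "l \<le> k")
    case True
    then obtain j where j: "k = l + j" using le_Suc_ex by blast
    have "(2 ^ j * u * v') * b = 2 ^ (l + j) * u * (v * v')"
      unfolding b by (simp only: power_add ac_simps)
    then have "a * 1 = (2 ^ j * u * v') * b"
      unfolding v' a j by (simp only: mult_1_right)
    then have "c = to_fract (2 ^ j * u * v')"
      unfolding c to_fract_def using c(2) by (simp add: eq_fract)
    then show ?thesis using that(1) by blast
  next
    case False
    then obtain j where "l = k + Suc j" by (metis less_imp_Suc_add add_Suc_right not_le)
    then have "2 ^ l = (2 :: two_adic_int) ^ k * (2 * 2 ^ j)" by (simp add: power_add)
    then have "2 ^ l * v * (u * u') = a * (2 * (2 ^ j * v * u'))"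
      unfolding a by (simp only: ac_simps)
    then have "b * 1 = a * (2 * (2 ^ j * v * u'))"
      unfolding u' b by simp
    then have "c * to_fract (2 * (2 ^ j * v * u')) = 1"
      unfolding c to_fract_def using c(2) by (simp add: eq_fract One_fract_def)
    then show ?thesis using that(2) by blast
  qed
qed

text \<open>
Even exponents contribute squares, and for odd \<open>k\<close> the power \<open>(2 k)\<^sup>k\<close> lies in the class of \<open>2 k\<close>.
\<close>

lemma prod_in_square_class:
  "in_square_class (\<Sum>k<n. k mod 2) (\<Prod>k<n. if even k then 1 else int k) (\<Prod>k<n. (2 * of_nat k) ^ k)"
proof (induction n)
  case 0
  show ?case using in_square_class_nonzero_square[OF one_neq_zero] by (simp only: lessThan_0 sum.empty prod.empty power_one)
next
  case (Suc k)
  have nz: "(2 * of_nat k :: two_adic) ^ j \<noteq> 0" if "k > 0" for j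
    using two_adic_of_nat_nonzero[OF that] two_adic_two_nonzero by (intro power_not_zero no_zero_divisors)
  have "in_square_class (k mod 2) (if even k then 1 else int k) ((2 * of_nat k) ^ k)"
  proof (cases "even k")
    case True
    then obtain j where j: "j * 2 = k" by (metis evenE mult.commute)
    have "(2 * of_nat k :: two_adic) ^ j \<noteq> 0"
    proof (cases "j = 0")
      case False
      then show ?thesis by (intro nz) (use j in simp)
    qed (simp only: power_0 one_neq_zero not_False_eq_True)
    from in_square_class_nonzero_square[OF this] have "in_square_class 0 1 ((2 * of_nat k) ^ k)"
      unfolding power_mult[symmetric] j .
    moreover have "k mod 2 = 0" using True by presburger
    ultimately show ?thesis using True by (simp only: if_True)
  next
    case False
    then obtain j where j: "k = Suc (j * 2)" by (metis oddE Suc_eq_plus1 mult.commute)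
    have "(2 * of_nat k :: two_adic) ^ j \<noteq> 0"
      by (rule nz) (use j in simp)
    then have "in_square_class (1 + 0) (residue (of_nat k) 3 * 1) (to_fract (2 ^ 1 * of_nat k) * ((2 * of_nat k) ^ j)\<^sup>2)"
      by (intro in_square_class_mult in_square_class_integer in_square_class_nonzero_square)
    moreover have "to_fract (2 ^ 1 * of_nat k) * ((2 * of_nat k) ^ j)\<^sup>2 = (2 * of_nat k :: two_adic) ^ k"
    proof -
      have "(2 * of_nat k :: two_adic) ^ k = (2 * of_nat k) ^ Suc (j * 2)" by (subst (2) j) (rule refl)
      then show ?thesis
        by (simp only: power_Suc power_mult to_fract_mult to_fract_of_nat to_fract_numeral power_one_right)
    qed
    moreover have "residue (of_nat k) 3 = int k mod 8" by (simp add: residue_of_nat)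
    ultimately have "in_square_class 1 (int k) ((2 * of_nat k) ^ k)"
      by (simp only: in_square_class_mod add_0_right mult_1_right)
    moreover have "k mod 2 = 1" using False by presburger
    ultimately show ?thesis using False by (simp only: if_False)
  qed
  from in_square_class_mult[OF Suc this] show ?case by (simp only: sum.lessThan_Suc prod.lessThan_Suc)
qed

section \<open>Hermite forms modulo 8\<close>
text \<open>
What remains of \<open>hermite_form n (2 v) s\<close> after division by \<open>2\<^bsup>\<lceil>n/2\<rceil>\<^esup>\<close>, see
\<open>hermite_form_double\<close>.
\<close>

fun halved_form :: "nat \<Rightarrow> 'a \<Rightarrow> 'a \<Rightarrow> 'a :: comm_ring_1" where
  "halved_form 0 v s = 1"
| "halved_form (Suc 0) v s = v"
| "halved_form (Suc (Suc n)) v s =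
     (if even n then 2 else 1) * v * halved_form (Suc n) v s - of_nat (Suc n) * s * halved_form n v s"

text \<open>
The recursion without successors, so that the simplifier can evaluate the forms at numerals.
\<close>

lemma hermite_form_rec:
  assumes "n \<ge> 2"
  shows "hermite_form n w s =
    w * hermite_form (n - 1) w s - 2 * of_nat (n - 1) * s * hermite_form (n - 2) w s"
proof -
  obtain m where "n = Suc (Suc m)" using assms by (metis Suc_le_D numeral_2_eq_2 Suc_le_mono)
  then show ?thesis by simp
qed

lemma halved_form_rec:
  assumes "n \<ge> 2"
  shows "halved_form n v s = (if even n then 2 else 1) * v * halved_form (n - 1) v s
     - of_nat (n - 1) * s * halved_form (n - 2) v s"
proof -
  obtain m where "n = Suc (Suc m)" using assms by (metis Suc_le_D numeral_2_eq_2 Suc_le_mono)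
  then show ?thesis by simp
qed

lemmas hermite_form_numeral [simp] = hermite_form_rec[of "numeral k" for k]
lemmas halved_form_numeral [simp] = halved_form_rec[of "numeral k" for k]

lemma hermite_form_double:
  "hermite_form n (2 * v) s = 2 ^ ((n + 1) div 2) * halved_form n v s"
proof (induction n v s rule: halved_form.induct)
  case (3 n v s)
  show ?case
  proof (cases "even n")
    case True
    then have e: "(Suc n + 1) div 2 = Suc (n div 2)" "(n + 1) div 2 = n div 2" "(Suc (Suc n) + 1) div 2 = Suc (n div 2)"
      by presburger+
    show ?thesis
      unfolding hermite_form.simps halved_form.simps 3 e using True by (simp add: algebra_simps)
  next
    case False
    then have e: "(Suc n + 1) div 2 = (n + 1) div 2" "(Suc (Suc n) + 1) div 2 = Suc ((n + 1) div 2)"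
      by presburger+
    show ?thesis
      unfolding hermite_form.simps halved_form.simps 3 e using False by (simp add: algebra_simps)
  qed
qed simp_all

lemma residue_hermite_form:
  "residue (hermite_form n w s) k = hermite_form n (residue w k) (residue s k) mod 2 ^ k"
proof (induction n w s rule: hermite_form.induct)
  case (3 n w s)
  have "residue (2 * of_nat (Suc n)) k = (2 * of_nat (Suc n)) mod 2 ^ k"
    by (simp add: residue_mult residue_numeral residue_of_nat mod_mult_eq del: of_nat_Suc)
  then show ?case unfolding hermite_form.simps residue_diff residue_mult[of _ "hermite_form _ _ _"]
      residue_mult[of _ s] residue_mult[of w] 3
    by (simp only: mod_mult_eq mod_mult_left_eq mod_mult_right_eq mod_diff_eq)
qed (simp_all add: one_two_adic_int.rep_eq)

lemma residue_halved_form: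
  "residue (halved_form n w s) k = halved_form n (residue w k) (residue s k) mod 2 ^ k"
proof (induction n w s rule: halved_form.induct)
  case (3 n w s)
  have "residue (if even n then 2 else 1) k = (if even n then 2 else 1) mod 2 ^ k"
    by (simp add: residue_numeral one_two_adic_int.rep_eq)
  then show ?case unfolding halved_form.simps residue_diff residue_mult 3 residue_of_nat
    by (simp only: mod_mult_eq mod_mult_left_eq mod_mult_right_eq mod_diff_eq)
qed (simp_all add: one_two_adic_int.rep_eq)

lemma hermite_form_mod:
  "hermite_form n (w mod m) (s mod m) mod m = hermite_form n w s mod (m :: int)"
proof (induction n w s rule: hermite_form.induct)
  case (3 n w s)
  show ?case unfolding hermite_form.simps by (intro mod_diff_cong mod_mult_cong refl mod_mod_trivial 3)
qed simp_all

lemma halved_form_mod: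
  "halved_form n (w mod m) (s mod m) mod m = halved_form n w s mod (m :: int)"
proof (induction n w s rule: halved_form.induct)
  case (3 n w s)
  show ?case unfolding halved_form.simps by (intro mod_diff_cong mod_mult_cong refl mod_mod_trivial 3)
qed simp_all

lemma mod_8_cases: "(x :: int) mod 8 \<in> {0, 1, 2, 3, 4, 5, 6, 7}"
proof -
  have "0 \<le> x mod 8" "x mod 8 < 8" by simp_all
  then show ?thesis by auto
qed

lemma odd_mod_8_cases: "odd (x :: int) \<Longrightarrow> x mod 8 \<in> {1, 3, 5, 7}"
  using mod_8_cases[of x] by auto presburger+

text \<open>
The coefficients \<open>2 (n + 1)\<close> of the recursion have period dividing 8 modulo 8, so it suffices to compare
two consecutive initial values.  By the expansion into monomials, \<open>hermite_form 8 w s\<close> is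
congruent to \<open>w\<^sup>8\<close> and \<open>hermite_form 9 w s\<close> to \<open>w\<^sup>9\<close> modulo 8; here all residues of \<open>w\<close> and \<open>s\<close>
are checked.
\<close>

lemma hermite_form_plus_8:
  fixes w s :: int
  assumes "odd w"
  shows "hermite_form (n + 8) w s mod 8 = hermite_form n w s mod 8"
  using assms
proof (induction n w s rule: hermite_form.induct)
  case (1 w s)
  have "\<forall>a \<in> {1, 3, 5, 7}. \<forall>b \<in> {0, 1, 2, 3, 4, 5, 6, 7 :: int}. hermite_form 8 a b mod 8 = 1"
    by simp
  from bspec[OF bspec[OF this odd_mod_8_cases[OF 1]] mod_8_cases[of s]] have "hermite_form 8 (w mod 8) (s mod 8) mod 8 = 1" .
  then show ?case unfolding hermite_form_mod by simp
next
  case (2 w s)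
  have "\<forall>a \<in> {1, 3, 5, 7}. \<forall>b \<in> {0, 1, 2, 3, 4, 5, 6, 7 :: int}. hermite_form 9 a b mod 8 = a"
    by simp
  from bspec[OF bspec[OF this odd_mod_8_cases[OF 2]] mod_8_cases[of s]] have "hermite_form 9 (w mod 8) (s mod 8) mod 8 = w mod 8" .
  then show ?case unfolding hermite_form_mod by simp
next
  case (3 n w s)
  have "2 * of_nat (Suc (n + 8)) mod 8 = (2 * of_nat (Suc n) :: int) mod 8" by simp presburger
  from mod_diff_cong[OF mod_mult_cong[OF refl 3(1)] mod_mult_cong[OF mod_mult_cong[OF this refl] 3(2)]] 3(3)
  show ?case unfolding hermite_form.simps add_Suc by blast
qed

text \<open>
As for \<open>hermite_form_plus_8\<close>; the initial values at 8 and 9 are \<open>s\<^sup>4\<close> and \<open>s\<^sup>4 v\<close> modulo 8.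
\<close>

lemma halved_form_plus_8:
  fixes v s :: int
  assumes "s mod 8 = 1"
  shows "halved_form (n + 8) v s mod 8 = halved_form n v s mod 8"
  using assms
proof (induction n v s rule: halved_form.induct)
  case (1 v s)
  have "halved_form 8 (v mod 8) (s mod 8) mod 8 = 1"
  proof -
    have "\<forall>a \<in> {0, 1, 2, 3, 4, 5, 6, 7 :: int}. halved_form 8 a 1 mod 8 = 1"
      by simp
    from bspec[OF this mod_8_cases[of v]] show ?thesis unfolding 1 .
  qed
  then show ?case unfolding halved_form_mod by simp
next
  case (2 v s)
  have "halved_form 9 (v mod 8) (s mod 8) mod 8 = v mod 8"
  proof -
    have "\<forall>a \<in> {0, 1, 2, 3, 4, 5, 6, 7 :: int}. halved_form 9 a 1 mod 8 = a"
      by simp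
    from bspec[OF this mod_8_cases[of v]] show ?thesis unfolding 2 .
  qed
  then show ?case unfolding halved_form_mod by simp
next
  case (3 n v s)
  have "of_nat (Suc (n + 8)) mod 8 = (of_nat (Suc n) :: int) mod 8" by simp presburger
  from mod_diff_cong[OF mod_mult_cong[OF refl 3(1)] mod_mult_cong[OF mod_mult_cong[OF this refl] 3(2)]] 3(3)
  have "((if even n then 2 else 1) * v * halved_form (Suc n + 8) v s
      - of_nat (Suc (n + 8)) * s * halved_form (n + 8) v s) mod 8 =
    ((if even n then 2 else 1) * v * halved_form (Suc n) v s - of_nat (Suc n) * s * halved_form n v s) mod 8"
    by blast
  then show ?case unfolding halved_form.simps add_Suc by simp
qed

lemma periodic_mod_8:
  assumes "\<And>n. f (n + 8) = f n"
  shows "f n = f (n mod 8 :: nat)"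
proof -
  have "f (r + 8 * q) = f r" for q r
    by (induction q) (simp, metis assms add.assoc add.commute mult_Suc_right)
  from this[of "n mod 8" "n div 8"] show ?thesis by simp
qed

lemma hermite_form_mod_8:
  fixes w s :: int
  assumes "odd w"
  shows "hermite_form n w s mod 8 = hermite_form (n mod 8) (w mod 8) (s mod 8) mod 8"
  using periodic_mod_8[of "\<lambda>n. hermite_form n w s mod 8" n] hermite_form_plus_8[OF assms]
  by (simp add: hermite_form_mod)

lemma halved_form_mod_8:
  fixes v s :: int
  assumes "s mod 8 = 1"
  shows "halved_form n v s mod 8 = halved_form (n mod 8) (v mod 8) 1 mod 8"
  using periodic_mod_8[of "\<lambda>n. halved_form n v s mod 8" n] halved_form_plus_8[OF assms]
    halved_form_mod[of _ v 8 s] assms by simp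

section \<open>The square class of the discriminant\<close>
text \<open>
The common shape of \<open>disc_factor\<close> and of its quotients by powers of 2: the descent changes \<open>a\<close>, \<open>b\<close>,
\<open>w\<close> and \<open>s\<close>, but not the index \<open>n\<close>.
\<close>

definition hermite_pencil :: "nat \<Rightarrow> 'a \<Rightarrow> 'a \<Rightarrow> 'a \<Rightarrow> 'a \<Rightarrow> 'a :: comm_ring_1" where
  "hermite_pencil n a b w s = a * hermite_form (n - 1) w s - b * s * hermite_form (n - 2) w s"

definition halved_pencil :: "nat \<Rightarrow> 'a \<Rightarrow> 'a \<Rightarrow> 'a \<Rightarrow> 'a \<Rightarrow> 'a :: comm_ring_1" where
  "halved_pencil n a b v s = a * halved_form (n - 1) v s - b * s * halved_form (n - 2) v s"

lemma disc_factor_eq_pencil: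
  "disc_factor n s = hermite_pencil n (of_nat n) (of_nat (n - 1)) (2 * of_nat n + s) s"
  by (simp add: disc_factor_def hermite_pencil_def)

lemma hermite_pencil_scale:
  assumes "n \<ge> 2"
  shows "hermite_pencil n a b (2 * w) (4 * s) = 2 ^ (n - 1) * hermite_pencil n a (2 * b) w s"
proof -
  obtain m where m: "n = Suc (Suc m)" using assms by (metis Suc_le_D numeral_2_eq_2 Suc_le_mono)
  have "hermite_form k (2 * w) (4 * s) = 2 ^ k * hermite_form k w s" for k
    using hermite_form_scale[of k 2 w s] by simp
  then show ?thesis unfolding hermite_pencil_def m by (simp add: algebra_simps del: hermite_form.simps)
qed

lemma hermite_pencil_double_coeffs:
  "hermite_pencil n (2 * a) (2 * b) w s = 2 * hermite_pencil n a b w s"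
  by (simp add: hermite_pencil_def algebra_simps)

text \<open>
For even \<open>n\<close> the indices \<open>n - 1\<close> and \<open>n - 2\<close> yield the powers \<open>2\<^sup>m\<close> and \<open>2\<^bsup>m-1\<^esup>\<close>; the factor
2 in front of \<open>b\<close> makes up for the difference.
\<close>

lemma hermite_pencil_halve:
  assumes "n = 2 * m" "m > 0"
  shows "hermite_pencil n a (2 * b) (2 * v) s = 2 ^ m * halved_pencil n a b v s"
proof -
  obtain k where k: "m = Suc k" using assms(2) by (metis gr0_implies_Suc)
  have e: "(n - 1 + 1) div 2 = Suc k" "(n - 2 + 1) div 2 = k"
    using assms(1) k by auto
  show ?thesis
    unfolding hermite_pencil_def halved_pencil_def hermite_form_double e k by (simp add: algebra_simps)
qed

lemma nat_mod_8_cases: "(k :: nat) mod 8 \<in> {0, 1, 2, 3, 4, 5, 6, 7}"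
proof -
  have "k mod 8 < 8" by simp
  then show ?thesis unfolding insert_iff empty_iff by linarith
qed

lemma residue_mod_8: "residue x 3 mod 8 = residue x 3"
  using residue_mod_self[of x 3] by simp

lemma diff_mod_8: "k \<le> n mod 8 \<Longrightarrow> (n - k) mod 8 = n mod 8 - (k :: nat)"
proof -
  assume k: "k \<le> n mod 8"
  then have "n - k = (n mod 8 - k) + 8 * (n div 8)"
    using div_mult_mod_eq[of n 8] by linarith
  then have "(n - k) mod 8 = (n mod 8 - k) mod 8" by (simp only: mod_mult_self2)
  then show ?thesis by (simp add: less_imp_diff_less)
qed

lemma residue_hermite_pencil:
  assumes "n mod 8 \<ge> 2" and w: "odd (residue w 3)"
  shows "residue (hermite_pencil n a b w s) 3 =
    hermite_pencil (n mod 8) (residue a 3) (residue b 3) (residue w 3) (residue s 3) mod 8"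
proof -
  have e: "(n - 1) mod 8 = n mod 8 - 1" "(n - 2) mod 8 = n mod 8 - 2"
    using assms(1) by (simp_all add: diff_mod_8)
  have h: "residue (hermite_form k w s) 3 = hermite_form (k mod 8) (residue w 3) (residue s 3) mod 8" for k
    unfolding residue_hermite_form using hermite_form_mod_8[OF w, of k "residue s 3"]
    by (simp only: residue_mod_8) simp
  show ?thesis
    unfolding hermite_pencil_def residue_diff residue_mult h e
    by (simp add: mod_mult_eq mod_mult_left_eq mod_mult_right_eq mod_diff_eq)
qed

lemma residue_halved_pencil:
  assumes "n mod 8 \<ge> 2" and s: "residue s 3 = 1"
  shows "residue (halved_pencil n a b v s) 3 =
    halved_pencil (n mod 8) (residue a 3) (residue b 3) (residue v 3) 1 mod 8"
proof -
  have e: "(n - 1) mod 8 = n mod 8 - 1" "(n - 2) mod 8 = n mod 8 - 2"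
    using assms(1) by (simp_all add: diff_mod_8)
  have h: "residue (halved_form k v s) 3 = halved_form (k mod 8) (residue v 3) 1 mod 8" for k
    unfolding residue_halved_form s using halved_form_mod_8[of 1 k "residue v 3"]
    by (simp only: residue_mod_8) simp
  show ?thesis
    unfolding halved_pencil_def residue_diff residue_mult h e s
    by (simp add: mod_mult_eq mod_mult_left_eq mod_mult_right_eq mod_diff_eq)
qed

text \<open>
The square class of the factor of the discriminant in front of \<open>disc_factor\<close>, for
\<open>n mod 8\<close> between 3 and 7, see \<open>constant_in_square_class\<close>.
\<close>

definition constant_class :: "nat \<Rightarrow> nat \<times> int" where
  "constant_class n = (if n mod 8 = 3 then (1, 1) else if n mod 8 = 4 then (1, 3)
     else if n mod 8 = 5 then (0, 3) else if n mod 8 = 6 then (0, 7) else (1, 7))"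

text \<open>
A value of \<open>disc_factor\<close> in the class of \<open>2\<^sup>e r\<close> makes the discriminant a nonsquare: the classes have
order at most 2, so the product of two of them is trivial only if they are equal.
\<close>

definition obstructed :: "nat \<Rightarrow> nat \<Rightarrow> int \<Rightarrow> bool" where
  "obstructed n e r \<longleftrightarrow> odd r \<and> (e mod 2, r mod 8) \<noteq> constant_class n"

lemma residue_square_cases: "residue (y\<^sup>2) 3 \<in> {0, 1, 4}"
proof -
  have "residue y 3 \<in> {0, 1, 2, 3, 4, 5, 6, 7}"
    using mod_8_cases[of "residue y 3"] residue_mod_self[of y 3] by simp
  then show ?thesis by (auto simp: residue_power)
qed

lemma two_adic_int_cases:
  obtains "residue x 1 = 1" | y where "x = 2 * y"
  using residue_1_cases[of x] residue_1_eq_0E[of x] by metis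

lemma residue_of_nat_3: "residue (of_nat k) 3 = int (k mod 8)"
  by (simp add: residue_of_nat zmod_int)

lemma disc_factor_odd:
  assumes n: "n mod 8 \<in> {3, 4, 5, 6, 7}" and x: "residue x 1 = 1"
  shows "obstructed n 0 (residue (disc_factor n (x\<^sup>2)) 3)"
proof -
  have s: "residue (x\<^sup>2) 3 = 1" by (rule residue_square[OF x])
  have n1: "(n - 1) mod 8 = n mod 8 - 1" using n by (intro diff_mod_8) auto
  have w: "residue (2 * of_nat n + x\<^sup>2) 3 = (2 * int (n mod 8) + 1) mod 8"
    by (simp only: residue_add residue_mult residue_numeral residue_of_nat_3 s) (simp add: mod_simps)
  have "odd (residue (2 * of_nat n + x\<^sup>2) 3)" unfolding w by presburger
  then have "residue (disc_factor n (x\<^sup>2)) 3 = hermite_pencil (n mod 8) (int (n mod 8)) (int (n mod 8 - 1))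
      ((2 * int (n mod 8) + 1) mod 8) 1 mod 8"
    unfolding disc_factor_eq_pencil
    by (subst residue_hermite_pencil) (use n in \<open>auto simp only: w s residue_of_nat_3 n1\<close>)
  then show ?thesis
    unfolding obstructed_def constant_class_def using n
    by (elim insertE emptyE) (simp_all add: hermite_pencil_def)
qed

text \<open>
The pencils to which the descent reduces \<open>disc_factor\<close> when it ends with an odd argument \<open>w\<close>.
\<close>

lemma residue_quotient_pencil:
  fixes y :: two_adic_int
  defines "t \<equiv> residue (y\<^sup>2) 3"
  assumes "n mod 8 \<ge> 2" "odd k" "even l"
  shows "residue (hermite_pencil n (of_nat j) (2 * of_nat (n - 1)) (of_nat k + of_nat l * y\<^sup>2) (y\<^sup>2)) 3 =
    hermite_pencil (n mod 8) (int (j mod 8)) (2 * int (n mod 8 - 1) mod 8) ((int (k mod 8) + int l * t) mod 8) t mod 8"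
proof -
  have n1: "(n - 1) mod 8 = n mod 8 - 1" using assms(2) by (intro diff_mod_8) auto
  have w: "residue (of_nat k + of_nat l * y\<^sup>2) 3 = (int (k mod 8) + int l * t) mod 8"
    unfolding residue_add residue_mult residue_of_nat_3 t_def by (simp add: zmod_int mod_simps)
  have b: "residue (2 * of_nat (n - 1)) 3 = 2 * int (n mod 8 - 1) mod 8"
    by (simp only: residue_mult residue_numeral residue_of_nat_3 n1) (simp add: mod_simps)
  have "odd (residue (of_nat k + of_nat l * y\<^sup>2) 3)"
    unfolding w using assms(3,4) by (simp add: zmod_int dvd_mod_iff)
  then show ?thesis
    using assms(2) unfolding t_def by (subst residue_hermite_pencil) (auto simp only: w b residue_of_nat_3 t_def)
qed

lemma residue_halved_pencil_even:
  assumes "n mod 8 \<ge> 2" "residue y 1 = 1"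
  shows "residue (halved_pencil n (of_nat j) (of_nat (n - 1)) (of_nat k + of_nat l * y\<^sup>2) (y\<^sup>2)) 3 =
    halved_pencil (n mod 8) (int (j mod 8)) (int (n mod 8 - 1)) (int ((k mod 8 + l) mod 8)) 1 mod 8"
proof -
  have s: "residue (y\<^sup>2) 3 = 1" by (rule residue_square[OF assms(2)])
  have n1: "(n - 1) mod 8 = n mod 8 - 1" using assms by (intro diff_mod_8) auto
  have v: "residue (of_nat k + of_nat l * y\<^sup>2) 3 = int ((k mod 8 + l) mod 8)"
    unfolding residue_add residue_mult residue_of_nat_3 s by (simp add: zmod_int mod_simps)
  show ?thesis
    using assms(1) by (subst residue_halved_pencil) (auto simp only: s v residue_of_nat_3 n1)
qed

text \<open>
One step of the descent for even \<open>n\<close> and even \<open>y\<close>, in which \<open>a\<close> and \<open>w\<close> are halved and \<open>s\<close> is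
divided by 4.
\<close>

lemma hermite_pencil_descend:
  assumes "n \<ge> 2"
  shows "hermite_pencil n (2 * a) (2 * b) (2 * w) (4 * s) = 2 ^ n * hermite_pencil n a (2 * b) w s"
proof -
  have "hermite_pencil n (2 * a) (2 * b) (2 * w) (4 * s) = (2 * 2 ^ (n - 1)) * hermite_pencil n a (2 * b) w s"
    unfolding hermite_pencil_scale[OF assms] hermite_pencil_double_coeffs by simp
  also have "2 * 2 ^ (n - 1) = (2 :: 'a) ^ n"
    using assms by (cases n) simp_all
  finally show ?thesis .
qed

lemma disc_factor_double:
  assumes "n \<ge> 2"
  shows "disc_factor n ((2 * y)\<^sup>2) =
    2 ^ (n - 1) * hermite_pencil n (of_nat n) (2 * of_nat (n - 1)) (of_nat n + of_nat 2 * y\<^sup>2) (y\<^sup>2)"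
  using hermite_pencil_scale[OF assms, of "of_nat n" "of_nat (n - 1)" "of_nat n + of_nat 2 * y\<^sup>2" "y\<^sup>2"]
  by (simp add: disc_factor_eq_pencil power_mult_distrib distrib_left)

lemma disc_factor_even_odd:
  assumes n: "n mod 8 \<in> {3, 5, 7}"
  obtains u where "disc_factor n ((2 * y)\<^sup>2) = 2 ^ (n - 1) * u" "obstructed n (n - 1) (residue u 3)"
proof
  let ?u = "hermite_pencil n (of_nat n) (2 * of_nat (n - 1)) (of_nat n + of_nat 2 * y\<^sup>2) (y\<^sup>2)"
  have "2 \<le> n" using n by (cases "n < 2") (auto simp: less_Suc_eq numeral_2_eq_2)
  then show "disc_factor n ((2 * y)\<^sup>2) = 2 ^ (n - 1) * ?u"
    by (rule disc_factor_double)
  have n8: "n mod 8 \<ge> 2" using n by auto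
  have "odd (n mod 8)" using n by auto
  then have odd: "odd n" by (simp add: dvd_mod_iff)
  then have e: "(n - 1) mod 2 = 0" by simp
  show "obstructed n (n - 1) (residue ?u 3)"
    unfolding residue_quotient_pencil[OF n8 odd even_numeral] obstructed_def constant_class_def e
    using n residue_square_cases[of y]
    by (elim insertE emptyE) (simp_all add: hermite_pencil_def)
qed

text \<open>
The descent goes on as long as both the current quotient \<open>n / 2\<^sup>i\<close> and \<open>y\<close> are even.  It ends with
\<open>halved_pencil\<close> if \<open>y\<close> becomes odd first, and with \<open>hermite_pencil\<close> at an odd argument
if the quotient becomes odd.  As \<open>n\<close> is divisible by 2 or 4 only, there are at most
two rounds.
\<close>

lemma disc_factor_even_even:
  assumes n: "n mod 8 \<in> {4, 6}"
  obtains e u where "disc_factor n ((2 * y)\<^sup>2) = 2 ^ e * u" "obstructed n e (residue u 3)"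
proof -
  have n2: "2 \<le> n" using n by (cases "n < 2") (auto simp: less_Suc_eq numeral_2_eq_2)
  have n8: "n mod 8 \<ge> 2" using n by auto
  have "even (n mod 8)" using n by auto
  then have "even n" by (simp add: dvd_mod_iff)
  then obtain m where m: "n = 2 * m" by blast
  then have m0: "m > 0" using n2 by simp
  have nm: "of_nat n = 2 * (of_nat m :: two_adic_int)" using m by simp
  have "n mod 8 = 2 * (m mod 4)" "m mod 4 = m mod 8 mod 4"
    unfolding m using mult_mod_right[of 2 m 4] by (simp_all add: mod_mod_cancel)
  then have m8: "n mod 8 = 4 \<and> m mod 8 \<in> {2, 6} \<or> n mod 8 = 6 \<and> m mod 8 \<in> {3, 7}"
    using n nat_mod_8_cases[of m] by (elim insertE emptyE) simp_all
  let ?b = "of_nat (n - 1) :: two_adic_int"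
  have y: "disc_factor n ((2 * y)\<^sup>2) =
      2 ^ (n - 1) * hermite_pencil n (2 * of_nat m) (2 * ?b) (2 * (of_nat m + y\<^sup>2)) (y\<^sup>2)"
    unfolding disc_factor_double[OF n2] nm by (simp add: distrib_left)
  show ?thesis
  proof (cases y rule: two_adic_int_cases)
    case 1
    let ?u = "halved_pencil n (of_nat n) ?b (of_nat m + of_nat 1 * y\<^sup>2) (y\<^sup>2)"
    have "disc_factor n ((2 * y)\<^sup>2) = 2 ^ (n - 1 + m) * ?u"
      unfolding y hermite_pencil_halve[OF m m0] nm by (simp add: power_add mult.assoc)
    moreover have "obstructed n (n - 1 + m) (residue ?u 3)"
    proof -
      have "odd (n - 1 + m) \<longleftrightarrow> even (m mod 8)" using m m0 by (simp add: dvd_mod_iff)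
      then have e: "(n - 1 + m) mod 2 = (if even (m mod 8) then 1 else 0)"
        by (simp only: mod_2_eq_odd of_bool_def)
      show ?thesis
        unfolding residue_halved_pencil_even[OF n8 1] obstructed_def constant_class_def e using m8
        by (elim disjE conjE insertE emptyE) (simp_all add: halved_pencil_def)
    qed
    ultimately show ?thesis by (rule that)
  next
    case (2 z)
    let ?w = "of_nat m + 4 * z\<^sup>2"
    have z: "disc_factor n ((2 * y)\<^sup>2) = 2 ^ (n - 1 + n) * hermite_pencil n (of_nat m) (2 * ?b) ?w (z\<^sup>2)"
      using hermite_pencil_descend[OF n2, of "of_nat m" ?b ?w "z\<^sup>2"]
      unfolding y unfolding 2 by (simp add: power_mult_distrib power_add mult.assoc)
    have e: "(n - 1 + n) mod 2 = 1" unfolding mod_2_eq_odd using m m0 by simp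
    show ?thesis
    proof (cases "n mod 8 = 6")
      case True
      \<comment> \<open>the odd exponent already excludes the class \<open>(0, 7)\<close>; of \<open>?u\<close> only the parity matters\<close>
      let ?u = "hermite_pencil n (of_nat m) (2 * ?b) (of_nat m + of_nat 4 * z\<^sup>2) (z\<^sup>2)"
      have "odd (m mod 8)" using m8 True by auto
      then have "odd m" by (simp add: dvd_mod_iff)
      have "obstructed n (n - 1 + n) (residue ?u 3)"
        unfolding residue_quotient_pencil[OF n8 \<open>odd m\<close> even_numeral] obstructed_def constant_class_def e
        using m8 True residue_square_cases[of z]
        by (elim disjE conjE insertE emptyE) (simp_all add: hermite_pencil_def)
      then show ?thesis using z by (intro that) simp_all
    next
      case False
      then have n4: "n mod 8 = 4" using n by auto
      have "even (m mod 8)" using m8 n4 by auto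
      then have "even m" by (simp add: dvd_mod_iff)
      then obtain k where k: "m = 2 * k" by blast
      have "m mod 8 = 2 * (k mod 4)" unfolding k using mult_mod_right[of 2 k 4] by simp
      then have "odd (k mod 4)" using m8 n4 by auto
      then have "odd k" using dvd_mod_iff[of 2 4 k] by simp
      then have "odd (k mod 8)" by (simp add: dvd_mod_iff)
      then have k8: "k mod 8 \<in> {1, 3, 5, 7}"
        using nat_mod_8_cases[of k] by (elim insertE emptyE) simp_all
      have m8k: "m mod 8 = 2 * (k mod 8) mod 8" unfolding k by (simp add: mod_mult_right_eq)
      have z': "disc_factor n ((2 * y)\<^sup>2) = 2 ^ (n - 1 + n) *
          hermite_pencil n (2 * of_nat k) (2 * ?b) (2 * (of_nat k + 2 * z\<^sup>2)) (z\<^sup>2)"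
        unfolding z k by (simp add: distrib_left)
      show ?thesis
      proof (cases z rule: two_adic_int_cases)
        case 1
        let ?u = "halved_pencil n (of_nat m) ?b (of_nat k + of_nat 2 * z\<^sup>2) (z\<^sup>2)"
        have "disc_factor n ((2 * y)\<^sup>2) = 2 ^ (n - 1 + n + m) * ?u"
          unfolding z' hermite_pencil_halve[OF m m0] k by (simp add: power_add mult.assoc)
        moreover have "obstructed n (n - 1 + n + m) (residue ?u 3)"
        proof -
          have e': "(n - 1 + n + m) mod 2 = 1"
            unfolding mod_2_eq_odd using m m0 \<open>even m\<close> by simp
          show ?thesis
            unfolding residue_halved_pencil_even[OF n8 1] obstructed_def constant_class_def e' m8k n4 using k8
            by (elim insertE emptyE) (simp_all add: halved_pencil_def)
        qed
        ultimately show ?thesis by (rule that)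
      next
        case (2 x)
        let ?u = "hermite_pencil n (of_nat k) (2 * ?b) (of_nat k + of_nat 8 * x\<^sup>2) (x\<^sup>2)"
        have "disc_factor n ((2 * y)\<^sup>2) = 2 ^ (n - 1 + n + n) * ?u"
          using hermite_pencil_descend[OF n2, of "of_nat k" ?b "of_nat k + 8 * x\<^sup>2" "x\<^sup>2"]
          unfolding z' 2 by (simp add: power_mult_distrib power_add mult.assoc)
        moreover have "obstructed n (n - 1 + n + n) (residue ?u 3)"
        proof -
          have e': "(n - 1 + n + n) mod 2 = 1"
            unfolding mod_2_eq_odd using m m0 by simp
          show ?thesis
            unfolding residue_quotient_pencil[OF n8 \<open>odd k\<close> even_numeral] obstructed_def constant_class_def e' n4
            using k8 residue_square_cases[of x]
            by (elim insertE emptyE) (simp_all add: hermite_pencil_def)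
        qed
        ultimately show ?thesis by (rule that)
      qed
    qed
  qed
qed

lemma disc_factor_integral:
  assumes n: "n mod 8 \<in> {3, 4, 5, 6, 7}"
  obtains e u where "disc_factor n (x\<^sup>2) = 2 ^ e * u" "obstructed n e (residue u 3)"
proof (cases x rule: two_adic_int_cases)
  case 1
  then show ?thesis using that[of 0 "disc_factor n (x\<^sup>2)"] disc_factor_odd[OF n] by simp
next
  case (2 y)
  show ?thesis
  proof (cases "n mod 8 \<in> {3, 5, 7}")
    case True
    then show ?thesis using that disc_factor_even_odd[of n y] 2 by metis
  next
    case False
    then have "n mod 8 \<in> {4, 6}" using n by auto
    then show ?thesis using that disc_factor_even_even[of n y] 2 by metis
  qed
qed

text \<open>
The reversed polynomial of \<open>disc_factor\<close>, in the variable \<open>r = 1 / s\<close>.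
\<close>

definition disc_factor_at_infinity :: "nat \<Rightarrow> 'a \<Rightarrow> 'a :: comm_ring_1" where
  "disc_factor_at_infinity n r = of_nat n * hermite_form (n - 1) (1 + 2 * of_nat n * r) r
     - of_nat (n - 1) * hermite_form (n - 2) (1 + 2 * of_nat n * r) r"

lemma disc_factor_inverse:
  assumes "n \<ge> 2" "r * s = 1"
  shows "disc_factor n s = s ^ (n - 1) * disc_factor_at_infinity n r"
proof -
  obtain m where m: "n = Suc (Suc m)" using assms by (metis Suc_le_D numeral_2_eq_2 Suc_le_mono)
  have s: "s * (r * x) = x" for x
    using assms(2) by (metis mult.assoc mult.commute mult_1)
  have w: "s * (1 + 2 * of_nat n * r) = 2 * of_nat n + s"
    using s[of "2 * of_nat n"] by (simp add: algebra_simps)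
  have r: "s\<^sup>2 * r = s" using s[of s] by (simp add: power2_eq_square ac_simps)
  have "hermite_form k (2 * of_nat n + s) s = s ^ k * hermite_form k (1 + 2 * of_nat n * r) r" for k
    using hermite_form_scale[of k s "1 + 2 * of_nat n * r" r] unfolding w r .
  then show ?thesis
    unfolding disc_factor_def disc_factor_at_infinity_def unfolding m
    by (simp add: algebra_simps del: hermite_form.simps)
qed

text \<open>
The hypothesis on \<open>r\<close> holds for the square of an even number; then \<open>w = 1 + 2 n r\<close> is congruent to
1 modulo 8, and modulo 4 both Hermite forms are 1, so that the value is congruent to
\<open>n - (n - 1) = 1\<close> modulo 4.
\<close>

lemma residue_disc_factor_at_infinity:
  assumes n: "n mod 8 \<in> {3, 4, 5, 6, 7}" and r: "residue r 3 \<in> {0, 4}"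
  shows "obstructed n 0 (residue (disc_factor_at_infinity n r) 3)"
proof -
  have e: "(n - 1) mod 8 = n mod 8 - 1" "(n - 2) mod 8 = n mod 8 - 2"
    using n by (intro diff_mod_8; auto)+
  have w: "residue (1 + 2 * of_nat n * r) 3 = 1"
  proof -
    have "residue (1 + 2 * of_nat n * r) 3 = (1 + 2 * int n * residue r 3) mod 8"
      by (simp only: residue_add residue_mult residue_numeral residue_of_nat one_two_adic_int.rep_eq)
        (simp add: mod_simps)
    also have "\<dots> = 1"
    proof -
      have "2 * int n * residue r 3 = 8 * (int n * (residue r 3 div 4))" using r by auto
      then show ?thesis by (simp only:) simp
    qed
    finally show ?thesis .
  qed
  have h: "residue (hermite_form k (1 + 2 * of_nat n * r) r) 3 = hermite_form (k mod 8) 1 (residue r 3) mod 8" for k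
    unfolding residue_hermite_form w using hermite_form_mod_8[of 1 k "residue r 3"]
    by (simp only: residue_mod_8) simp
  have "residue (disc_factor_at_infinity n r) 3 = (int (n mod 8) * hermite_form (n mod 8 - 1) 1 (residue r 3)
      - int (n mod 8 - 1) * hermite_form (n mod 8 - 2) 1 (residue r 3)) mod 8"
    unfolding disc_factor_at_infinity_def residue_diff residue_mult h e residue_of_nat_3
    by (simp add: mod_mult_eq mod_mult_left_eq mod_mult_right_eq mod_diff_eq)
  then show ?thesis
    unfolding obstructed_def constant_class_def using n r
    by (elim insertE emptyE) simp_all
qed

lemma to_fract_hermite_form:
  "to_fract (hermite_form k w s) = hermite_form k (to_fract w) (to_fract s)"
  by (induction k w s rule: hermite_form.induct)
    (simp_all add: to_fract_of_nat to_fract_numeral to_fract_diff)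

lemma disc_factor_in_square_class:
  fixes c :: two_adic
  assumes n: "n mod 8 \<in> {3, 4, 5, 6, 7}"
  obtains e r where "in_square_class e r (disc_factor n (c\<^sup>2))" "obstructed n e r"
proof (cases c rule: two_adic_cases)
  case (1 x)
  have "disc_factor n (c\<^sup>2) = to_fract (disc_factor n (x\<^sup>2))"
    by (simp add: 1 disc_factor_def to_fract_hermite_form to_fract_of_nat to_fract_numeral to_fract_power to_fract_diff)
  moreover obtain e u where "disc_factor n (x\<^sup>2) = 2 ^ e * u" "obstructed n e (residue u 3)"
    using disc_factor_integral[OF n] .
  ultimately show ?thesis using that in_square_class_integer by metis
next
  case (2 x)
  let ?r = "(2 * x)\<^sup>2"
  let ?u = "disc_factor_at_infinity n ?r"
  have "2 \<le> n" using n by (cases "n < 2") (auto simp: less_Suc_eq numeral_2_eq_2)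
  moreover have "to_fract ?r * c\<^sup>2 = 1"
    using 2 by (simp only: to_fract_power power_mult_distrib[symmetric] mult.commute power_one)
  ultimately have "disc_factor n (c\<^sup>2) = (c\<^sup>2) ^ (n - 1) * disc_factor_at_infinity n (to_fract ?r)"
    by (rule disc_factor_inverse)
  also have "disc_factor_at_infinity n (to_fract ?r) = to_fract ?u"
    by (simp only: disc_factor_at_infinity_def to_fract_hermite_form to_fract_of_nat to_fract_numeral
        to_fract_diff to_fract_mult to_fract_add to_fract_1)
  also have "(c\<^sup>2) ^ (n - 1) = (c ^ (n - 1))\<^sup>2"
    by (simp only: power_mult[symmetric] mult.commute)
  finally have "disc_factor n (c\<^sup>2) = (c ^ (n - 1))\<^sup>2 * to_fract (2 ^ 0 * ?u)" by simp
  moreover have "c ^ (n - 1) \<noteq> 0" using 2 by auto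
  ultimately have "in_square_class (0 + 0) (1 * residue ?u 3) (disc_factor n (c\<^sup>2))"
    using in_square_class_mult[OF in_square_class_nonzero_square in_square_class_integer] by metis
  moreover have "residue ?r 3 \<in> {0, 4}"
  proof -
    have "residue ?r 3 = 4 * residue (x\<^sup>2) 3 mod 8"
      unfolding power_mult_distrib residue_mult by (simp add: residue_numeral mod_simps)
    then show ?thesis
      using residue_square_cases[of x] by (elim insertE emptyE) simp_all
  qed
  ultimately show ?thesis using that residue_disc_factor_at_infinity[OF n] by simp
qed

text \<open>
Among eight consecutive numbers there are four odd ones, and their product is congruent to
\<open>1 * 3 * 5 * 7 = 105\<close>, that is to 1, modulo 8.
\<close>

lemma constant_class_periodic:
  defines "f \<equiv> \<lambda>n. ((\<Sum>k<n. k mod 2) mod 2, (\<Prod>k<n. if even k then 1 else int k) mod 8)"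
  shows "f (n + 8) = f n"
proof -
  let ?g = "\<lambda>k. if even k then 1 else int k"
  have split: "{..<n + 8} = {..<n} \<union> {n..<n + 8}" "{..<n} \<inter> {n..<n + 8} = {}" by auto
  have eight: "{n..<n + 8} = {n, n + 1, n + 2, n + 3, n + 4, n + 5, n + 6, n + 7}" by auto
  have odds: "(2 * a + 1) * ((2 * a + 3) * ((2 * a + 5) * (2 * a + 7))) mod 8 = 1" for a :: int
  proof -
    have "(2 * a + 1) * ((2 * a + 3) * ((2 * a + 5) * (2 * a + 7))) =
        1 + 8 * (2 * a ^ 4 + 16 * a ^ 3 + 43 * a ^ 2 + 44 * a + 13)"
      by (simp add: algebra_simps power2_eq_square power3_eq_cube power4_eq_xxxx)
    then show ?thesis by (simp only: mod_mult_self2) simp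
  qed
  have "(\<Sum>k=n..<n + 8. k mod 2) = 4 \<and> (\<Prod>k=n..<n + 8. ?g k) mod 8 = 1"
  proof (cases "even n")
    case True
    then obtain a where n: "n = 2 * a" by blast
    show ?thesis unfolding eight using odds[of "int a"] n by (simp add: mod_2_eq_odd algebra_simps)
  next
    case False
    then obtain a where n: "n = 2 * a + 1" by (rule oddE)
    show ?thesis unfolding eight using odds[of "int a"] n by (simp add: mod_2_eq_odd algebra_simps)
  qed
  moreover have "(\<Sum>k<n + 8. k mod 2) = (\<Sum>k<n. k mod 2) + (\<Sum>k=n..<n + 8. k mod 2)"
    "(\<Prod>k<n + 8. ?g k) = (\<Prod>k<n. ?g k) * (\<Prod>k=n..<n + 8. ?g k)"
    unfolding split(1) by (simp_all only: sum.union_disjoint prod.union_disjoint finite_lessThan finite_atLeastLessThan split(2))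
  moreover have "x * y mod 8 = x mod 8" if "y mod 8 = 1" for x y :: int
    using that by (metis mod_mult_right_eq mult.right_neutral)
  moreover have "(x + 4) mod 2 = x mod 2" for x :: nat
    by presburger
  ultimately show ?thesis unfolding f_def by simp
qed

lemma constant_in_square_class:
  assumes n: "n mod 8 \<in> {3, 4, 5, 6, 7}"
  obtains e r where "in_square_class e r (2 ^ (n * (n - 2)) * (\<Prod>k<n. (2 * of_nat k) ^ k) * 2)"
    "(e mod 2, r mod 8) = constant_class n"
proof
  let ?s = "\<lambda>n. \<Sum>k<n. k mod 2" and ?p = "\<lambda>n. \<Prod>k<n. if even k then 1 else int k"
  have two: "in_square_class k 1 (2 ^ k)" for k
    using in_square_class_integer[of k 1] by (simp add: one_two_adic_int.rep_eq to_fract_power to_fract_numeral)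
  show "in_square_class (n * (n - 2) + ?s n + 1) (1 * ?p n * 1) (2 ^ (n * (n - 2)) * (\<Prod>k<n. (2 * of_nat k) ^ k) * 2)"
    using in_square_class_mult[OF in_square_class_mult[OF two prod_in_square_class] two[of 1]] by (simp only: power_one_right)
  have sp: "(?s n mod 2, ?p n mod 8) = (?s (n mod 8) mod 2, ?p (n mod 8) mod 8)"
    by (rule periodic_mod_8[of "\<lambda>n. (?s n mod 2, ?p n mod 8)"]) (rule constant_class_periodic)
  have "even (n * (n - 2)) \<longleftrightarrow> even n" using n by (cases "n < 2") auto
  also have "\<dots> \<longleftrightarrow> even (n mod 8)" by (simp add: dvd_mod_iff)
  finally have n2: "n * (n - 2) mod 2 = (n mod 8) mod 2"
    unfolding mod_2_eq_odd by simp
  have e: "(n * (n - 2) + ?s n + 1) mod 2 = (n mod 8 + ?s (n mod 8) + 1) mod 2"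
    by (intro mod_add_cong n2 refl) (use sp in blast)
  show "((n * (n - 2) + ?s n + 1) mod 2, 1 * ?p n * 1 mod 8) = constant_class n"
    unfolding e using sp n unfolding constant_class_def
    by (elim insertE emptyE) (simp_all add: lessThan_nat_numeral)
qed

theorem theorem5p6:
  fixes n :: nat and c :: two_adic
  assumes "n > 0" and "n mod 8 \<in> {3, 4, 5, 6, 7}"
  shows "\<not> (\<exists>y :: two_adic.
    discriminant (map_poly of_int (hermite n) + smult c (map_poly of_int (hermite (n - 1))))
      = to_ac (y\<^sup>2))"
proof
  have n2: "2 \<le> n" using assms(2) by (cases "n < 2") (auto simp: less_Suc_eq numeral_2_eq_2)
  assume "\<exists>y. discriminant (map_poly of_int (hermite n) + smult c (map_poly of_int (hermite (n - 1)))) = to_ac (y\<^sup>2)"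
  then obtain y where "to_ac (2 ^ (n * (n - 2)) * (\<Prod>k<n. (2 * of_nat k) ^ k) * (2 * disc_factor n (c\<^sup>2))) = to_ac (y\<^sup>2)"
    unfolding discriminant_quasi_hermite[OF two_adic_two_nonzero n2] by blast
  then have y: "y\<^sup>2 = 2 ^ (n * (n - 2)) * (\<Prod>k<n. (2 * of_nat k) ^ k) * 2 * disc_factor n (c\<^sup>2)"
    by (simp only: to_ac_eq_iff mult.assoc)
  obtain e r where er: "in_square_class e r (2 ^ (n * (n - 2)) * (\<Prod>k<n. (2 * of_nat k) ^ k) * 2)"
    "(e mod 2, r mod 8) = constant_class n"
    using constant_in_square_class[OF assms(2)] .
  obtain f s where fs: "in_square_class f s (disc_factor n (c\<^sup>2))" "obstructed n f s"
    using disc_factor_in_square_class[OF assms(2)] .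
  have total: "in_square_class (e + f) (r * s) (y\<^sup>2)"
    unfolding y by (rule in_square_class_mult[OF er(1) fs(1)])
  have r: "r mod 8 \<in> {1, 3, 7}" using er(2) unfolding constant_class_def by (auto split: if_splits)
  then have "odd (r mod 8)" by auto
  then have "odd (r * s)" using fs(2) by (simp add: obstructed_def dvd_mod_iff)
  from in_square_class_square[OF total this] have ef: "even (e + f)" "r * s mod 8 = 1" by auto
  have "e mod 2 = f mod 2" using ef(1) by presburger
  \<comment> \<open>odd residues modulo 8 are their own inverses\<close>
  moreover have "r mod 8 = s mod 8"
  proof -
    have "(r mod 8) * (r mod 8) mod 8 = 1" using r by auto
    then have "s mod 8 = ((r mod 8) * (r mod 8) mod 8) * s mod 8" by (simp only: mult_1)
    also have "\<dots> = r * (r * s mod 8) mod 8"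
      by (simp only: mod_mult_eq mod_mult_left_eq mod_mult_right_eq mult.assoc)
    finally show ?thesis using ef(2) by simp
  qed
  ultimately show False using er(2) fs(2) by (simp add: obstructed_def)
qed

end
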